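(* Let $0<q<1$, $\sigma>0$, $0\le\gamma<2$, and assume that either $\gamma\in\{0,1\}$, or $\gamma\in(0,2)\setminus\{1\}$ and $q^{-1}(1-q)(1-q^{\gamma+1})(1-q^{\gamma+2})>1$. Let $\alpha\in[0,1)$ and let $\lambda_{\gamma,\sigma}(z;q)=\mathscr{E}_{\gamma,\sigma}(z^2;q)$, with $\lambda_{\gamma,\sigma}'$ its derivative in $z$. Then: (a) The radius of starlikeness of order $\alpha$ of $f_{\gamma,\sigma}(\cdot;q)$ is $r^{\star}_{\alpha}(f_{\gamma,\sigma}(z;q))=x_{\gamma,\sigma,1}(q)$, where $x_{\gamma,\sigma,1}(q)$ is the smallest positive zero $r$ of the equation $$r\lambda_{\gamma,\sigma}'(r;q)-(\gamma+1)(\alpha-1)\lambda_{\gamma,\sigma}(r;q)=0.$$ (b) The radius of starlikeness of order $\alpha$ of $g_{\gamma,\sigma}(\cdot;q)$ is $r^{\star}_{\alpha}(g_{\gamma,\sigma}(z;q))=y_{\gamma,\sigma,1}(q)$, where $y_{\gamma,\sigma,1}(q)$ is the smallest positive zero $r$ of the equation $$r\lambda_{\gamma,\sigma}'(r;q)-(\alpha-1)\lambda_{\gamma,\sigma}(r;q)=0.$$ (c) The radius of starlikeness of order $\alpha$ of $h_{\gamma,\sigma}(\cdot;q)$ is $r^{\star}_{\alpha}(h_{\gamma,\sigma}(z;q))=z_{\gamma,\sigma,1}(q)$, where $z_{\gamma,\sigma,1}(q)$ is the smallest positive zero $r$ of the equation $$\sqrt{r}\,\lambda_{\gamma,\sig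ma}'(\sqrt{r};q)-2(\alpha-1)\lambda_{\gamma,\sigma}(\sqrt{r};q)=0.$$
   Context: For $0<q<1$, $(a;q)_\infty=\prod_{k\ge1}(1-aq^{k-1})$ and the $q$-gamma function is $\Gamma_q(z)=\frac{(q;q)_\infty}{(q^z;q)_\infty}(1-q)^{1-z}$. For $\sigma>0$ and $0\le\gamma<2$ define the entire function $$\mathscr{E}_{\gamma,\sigma}(z;q)=\sum_{n\ge0}\frac{(-1)^n\sigma^{2n}q^{n(n-1)}}{\Gamma_q(2n+\gamma+1)}z^n .$$ Normalized functions: $f_{\gamma,\sigma}(z;q)=\left(z^{\gamma+1}\Gamma_q(\gamma+1)\mathscr{E}_{\gamma,\sigma}(z^2;q)\right)^{1/(\gamma+1)}$, meaning $z\left(\Gamma_q(\gamma+1)\mathscr{E}_{\gamma,\sigma}(z^2;q)\right)^{1/(\gamma+1)}$ on the largest disk $\mathbb{D}_\delta$ ($\delta\in(0,\infty]$) in which $z\mapsto\mathscr{E}_{\gamma,\sigma}(z^2;q)$ has no zeros, where the power is the analytic branch equal to $1$ at $z=0$; $g_{\gamma,\sigma}(z;q)=z\Gamma_q(\gamma+1)\mathscr{E}_{\gamma,\sigma}(z^2;q)$; $h_{\gamma,\sigma}(z;q)=z\Gamma_q(\gamma+1)\mathscr{E}_{\gamma,\sigma}(z;q)$. Write $\mathbb{D}_r=\{z\in\mathbb{C}:|z|<r\}$. For a function $f$ analytic in a disk centered at $0$ with $f(0)=0$, $f'(0)=1$, and $\alpha\in[0,1)$, the radius of starlikeness of order $\alpha$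 is $$r^\star_\alpha(f)=\sup\left\{r>0:\ \operatorname{Re}\left(\frac{zf'(z)}{f(z)}\right)>\alpha\ \text{for all } z\in\mathbb{D}_r\right\},$$ where $r$ ranges over radii such that $\mathbb{D}_r$ lies in the domain of $f$, and $zf'(z)/f(z)$ is taken to be $1$ at $z=0$ (the condition includes that $f$ has no zeros in $\mathbb{D}_r\setminus\{0\}$). *)

theory Defs
  imports "HOL-Complex_Analysis.Complex_Analysis"
begin

definition qpoch_inf :: "real \<Rightarrow> real \<Rightarrow> real" where
  "qpoch_inf a q = (\<Prod>k. 1 - a * q ^ k)"

text \<open>Only real arguments of the \<open>q\<close>-gamma function are needed: the coefficients of the
  series below use it at \<open>2 n + \<gamma> + 1 > 0\<close>.\<close>

definition q_gamma :: "real \<Rightarrow> real \<Rightarrow> real" where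
  "q_gamma q z = qpoch_inf q q / qpoch_inf (q powr z) q * (1 - q) powr (1 - z)"

definition E_fun :: "real \<Rightarrow> real \<Rightarrow> real \<Rightarrow> complex \<Rightarrow> complex" where
  "E_fun \<gamma> \<sigma> q z =
     (\<Sum>n. complex_of_real ((-1) ^ n * \<sigma> ^ (2 * n) * q ^ (n * (n - 1))
             / q_gamma q (2 * real n + \<gamma> + 1)) * z ^ n)"

definition lambda_fun :: "real \<Rightarrow> real \<Rightarrow> real \<Rightarrow> complex \<Rightarrow> complex" where
  "lambda_fun \<gamma> \<sigma> q z = E_fun \<gamma> \<sigma> q (z\<^sup>2)"

definition is_power_branch ::
  "complex set \<Rightarrow> (complex \<Rightarrow> complex) \<Rightarrow> real \<Rightarrow> (complex \<Rightarrow> complex) \<Rightarrow> bool" where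
  "is_power_branch D F s p \<longleftrightarrow>
     (\<exists>L. L holomorphic_on D \<and> (\<forall>z\<in>D. exp (L z) = F z \<and> p z = exp (of_real s * L z))) \<and> p 0 = 1"

text \<open>On the disks used below the branch exists and is unique, so that the choice in
  \<open>power_branch\<close> only concerns values outside \<open>D\<close>.\<close>

lemma is_power_branch_exists:
  assumes "open D" "convex D" "0 \<in> D" "F holomorphic_on D" "\<And>z. z \<in> D \<Longrightarrow> F z \<noteq> 0" "F 0 = 1"
  shows "\<exists>p. is_power_branch D F s p"
proof -
  have "simply_connected D" "locally path_connected D"
    using assms by (simp_all add: convex_imp_simply_connected open_imp_locally_path_connected)
  then have "\<exists>L. L holomorphic_on D \<and> (\<forall>z\<in>D. F z = exp (L z))"
    using simply_connected_imp_holomorphic_log[OF assms(4) _ _ assms(5)] by metis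
  then obtain L where L: "L holomorphic_on D" "\<And>z. z \<in> D \<Longrightarrow> F z = exp (L z)"
    by blast
  have e: "exp (L 0) = 1"
    using L(2)[OF \<open>0 \<in> D\<close>] \<open>F 0 = 1\<close> by simp
  have "(\<lambda>z. L z - L 0) holomorphic_on D"
    by (intro holomorphic_intros L)
  moreover have "\<forall>z\<in>D. exp (L z - L 0) = F z"
    using L(2) e by (simp add: exp_diff)
  ultimately have "is_power_branch D F s (\<lambda>z. exp (of_real s * (L z - L 0)))"
    unfolding is_power_branch_def by auto
  then show ?thesis by blast
qed

lemma is_power_branch_unique:
  assumes D: "open D" "convex D" "0 \<in> D"
    and p: "is_power_branch D F s p" and r: "is_power_branch D F s r" and "z \<in> D"
  shows "p z = r z"
proof -
  obtain L where L: "L holomorphic_on D" "\<And>z. z \<in> D \<Longrightarrow> exp (L z) = F z"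
      "\<And>z. z \<in> D \<Longrightarrow> p z = exp (of_real s * L z)" "p 0 = 1"
    using p unfolding is_power_branch_def by blast
  obtain M where M: "M holomorphic_on D" "\<And>z. z \<in> D \<Longrightarrow> exp (M z) = F z"
      "\<And>z. z \<in> D \<Longrightarrow> r z = exp (of_real s * M z)" "r 0 = 1"
    using r unfolding is_power_branch_def by blast
  have "((\<lambda>w. L w - M w) has_field_derivative 0) (at w within D)" if "w \<in> D" for w
  proof -
    have dL: "(L has_field_derivative deriv L w) (at w)"
      using L(1) D(1) that by (rule holomorphic_derivI)
    have dM: "(M has_field_derivative deriv M w) (at w)"
      using M(1) D(1) that by (rule holomorphic_derivI)
    have "((\<lambda>w. exp (L w)) has_field_derivative exp (L w) * deriv L w) (at w)"
      using dL by (rule DERIV_fun_exp)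
    moreover have "((\<lambda>w. exp (L w)) has_field_derivative exp (M w) * deriv M w) (at w)"
    proof (rule has_field_derivative_transform_within_open)
      show "((\<lambda>w. exp (M w)) has_field_derivative exp (M w) * deriv M w) (at w)"
        using dM by (rule DERIV_fun_exp)
    qed (use D that L(2) M(2) in auto)
    ultimately have "exp (L w) * deriv L w = exp (M w) * deriv M w"
      by (rule DERIV_unique)
    then have "deriv L w = deriv M w"
      using L(2)[OF that] M(2)[OF that] by (metis exp_not_eq_zero mult_cancel_left)
    then show ?thesis
      using has_field_derivative_at_within[OF DERIV_diff[OF dL dM]] by simp
  qed
  then have "\<exists>c. \<forall>w\<in>D. L w - M w = c"
    by (rule has_field_derivative_zero_constant[OF D(2)])
  then obtain c where c: "\<And>w. w \<in> D \<Longrightarrow> L w - M w = c"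
    by blast
  have q: "p w = exp (of_real s * c) * r w" if "w \<in> D" for w
  proof -
    have "L w = c + M w"
      using c[OF that] by (simp add: algebra_simps)
    then show ?thesis
      using L(3)[OF that] M(3)[OF that] by (simp add: distrib_left exp_add)
  qed
  have "exp (of_real s * c) = 1"
    using q[OF D(3)] L(4) M(4) by simp
  then show ?thesis
    using q[OF \<open>z \<in> D\<close>] by simp
qed

definition power_branch ::
  "complex set \<Rightarrow> (complex \<Rightarrow> complex) \<Rightarrow> real \<Rightarrow> complex \<Rightarrow> complex" where
  "power_branch D F s = (SOME p. is_power_branch D F s p)"

text \<open>The largest disk about 0 without zeros of \<open>\<lambda>\<close>; it is the whole plane if there are none.\<close>

definition f_domain :: "real \<Rightarrow> real \<Rightarrow> real \<Rightarrow> complex set" where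
  "f_domain \<gamma> \<sigma> q = \<Union> {ball 0 r | r. \<forall>z\<in>ball 0 r. lambda_fun \<gamma> \<sigma> q z \<noteq> 0}"

definition f_fun :: "real \<Rightarrow> real \<Rightarrow> real \<Rightarrow> complex \<Rightarrow> complex" where
  "f_fun \<gamma> \<sigma> q z =
     z * power_branch (f_domain \<gamma> \<sigma> q)
           (\<lambda>w. of_real (q_gamma q (\<gamma> + 1)) * lambda_fun \<gamma> \<sigma> q w) (1 / (\<gamma> + 1)) z"

definition g_fun :: "real \<Rightarrow> real \<Rightarrow> real \<Rightarrow> complex \<Rightarrow> complex" where
  "g_fun \<gamma> \<sigma> q z = z * of_real (q_gamma q (\<gamma> + 1)) * E_fun \<gamma> \<sigma> q (z\<^sup>2)"

definition h_fun :: "real \<Rightarrow> real \<Rightarrow> real \<Rightarrow> complex \<Rightarrow> complex" where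
  "h_fun \<gamma> \<sigma> q z = z * of_real (q_gamma q (\<gamma> + 1)) * E_fun \<gamma> \<sigma> q z"

definition starlike_quot :: "(complex \<Rightarrow> complex) \<Rightarrow> complex \<Rightarrow> complex" where
  "starlike_quot f z = (if z = 0 then 1 else z * deriv f z / f z)"

text \<open>\<open>D\<close> is the domain of \<open>f\<close>. The supremum is taken in the extended reals, so that an
  unbounded set of radii gives \<open>\<infinity>\<close>. Zeros of \<open>f\<close> are excluded explicitly because of
  \<open>x / 0 = 0\<close>.\<close>

definition starlike_radius :: "complex set \<Rightarrow> (complex \<Rightarrow> complex) \<Rightarrow> real \<Rightarrow> ereal" where
  "starlike_radius D f \<alpha> =
     Sup (ereal ` {r. 0 < r \<and> ball 0 r \<subseteq> D \<and> (\<forall>z\<in>ball 0 r - {0}. f z \<noteq> 0) \<and>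
                      (\<forall>z\<in>ball 0 r. Re (starlike_quot f z) > \<alpha>)})"

definition smallest_pos_zero :: "(real \<Rightarrow> complex) \<Rightarrow> real \<Rightarrow> bool" where
  "smallest_pos_zero F x \<longleftrightarrow> 0 < x \<and> F x = 0 \<and> (\<forall>y. 0 < y \<and> F y = 0 \<longrightarrow> x \<le> y)"

end

theory Submission
  imports Defs
begin

text \<open>Write \<open>F(w) = \<Gamma>\<^sub>q(\<gamma> + 1) \<E>(w)\<close> and \<open>- w F'(w) / F(w) = \<Sum> s\<^sub>n w\<^sup>n\<close>. No Hadamard factorisation and no
  information on non-real zeros is needed: everything follows from \<open>s\<^sub>n \<ge> \<beta>\<^sup>n\<close> for all \<open>n \<ge> 1\<close> and some \<open>\<beta> > 0\<close>.
  The radius of convergence \<open>R\<close> of \<open>S(w) = \<Sum> s\<^sub>n w\<^sup>n\<close> is then finite and is the smallest positive zero of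
  \<open>F\<close>, \<open>S\<close> increases from \<open>0\<close> to \<open>\<infinity>\<close> on \<open>[0, R)\<close>, and \<open>|S(w)| \<le> S(|w|)\<close>. Since \<open>z f'(z) / f(z) = 1 - k S(z\<^sup>m)\<close>
  for each of the three functions, the extremal point is the solution of \<open>k S(x\<^sup>m) = 1 - \<alpha>\<close> on the
  positive axis.

  For \<open>\<gamma>\<close> not an integer, the hypothesis forces \<open>q < 1/2\<close>, so that the ratios of consecutive coefficients
  of \<open>F\<close> drop by a factor of at least four, and the alternating sums in Newton's identities can be
  estimated by their first two terms. For \<open>\<gamma> \<in> {0, 1}\<close>, \<open>F\<close> is a Hahn--Exton \<open>q\<close>-Bessel function, and
  \<open>F(w) / F(q\<^sup>2 w) = 1 - V(w)\<close> where \<open>V\<close> has nonnegative coefficients.\<close>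

section \<open>Positivity of the logarithmic derivative\<close>

lemma mult_power_less_one:
  fixes a p :: real
  assumes "0 \<le> a" "a < 1" "0 \<le> p" "p \<le> 1"
  shows "a * p ^ n < 1"
proof -
  have "a * p ^ n \<le> a * 1" using assms by (intro mult_left_mono) (auto simp: power_le_one)
  then show ?thesis using assms by linarith
qed

text \<open>The Euler operator w d/dw is used instead of d/dw because it commutes with the dilations
  w -> p w below. With the minus sign the coefficients come out positive for the series considered
  here.\<close>

definition neg_log_deriv :: "'a::field fps \<Rightarrow> 'a fps" where
  "neg_log_deriv F = - (fps_X * fps_deriv F * inverse F)"

lemma neg_log_deriv_mult:
  fixes F :: "'a::field fps"
  assumes "fps_nth F 0 \<noteq> 0"
  shows "neg_log_deriv F * F = - (fps_X * fps_deriv F)"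
  using inverse_mult_eq_1[OF assms] by (simp add: neg_log_deriv_def mult.assoc)

lemma neg_log_deriv_unique:
  fixes F :: "'a::field fps"
  assumes "fps_nth F 0 \<noteq> 0" "S * F = - (fps_X * fps_deriv F)"
  shows "neg_log_deriv F = S"
proof -
  have "neg_log_deriv F * F = S * F" "F \<noteq> 0"
    using assms neg_log_deriv_mult by auto
  then show ?thesis by simp
qed

lemma neg_log_deriv_nth_0 [simp]: "fps_nth (neg_log_deriv F) 0 = 0"
  by (simp add: neg_log_deriv_def mult.assoc)

section \<open>Newton's identities for rapidly decreasing coefficient ratios\<close>

lemma alternating_sum_bounds:
  fixes t :: "nat \<Rightarrow> real"
  assumes "\<And>j. Suc j < m \<Longrightarrow> t (Suc j) \<le> t j" "\<And>j. j < m \<Longrightarrow> 0 \<le> t j" "0 < m"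
  shows "0 \<le> (\<Sum>j<m. (-1) ^ j * t j) \<and> (\<Sum>j<m. (-1) ^ j * t j) \<le> t 0"
  using assms
proof (induction m arbitrary: t)
  case (Suc m)
  have eq: "(\<Sum>j<Suc m. (-1) ^ j * t j) = t 0 - (\<Sum>j<m. (-1) ^ j * t (Suc j))"
    unfolding sum.lessThan_Suc_shift by (simp add: sum_negf)
  show ?case
  proof (cases "m = 0")
    case False
    then have "0 \<le> (\<Sum>j<m. (-1) ^ j * t (Suc j)) \<and> (\<Sum>j<m. (-1) ^ j * t (Suc j)) \<le> t (Suc 0)"
      using Suc.prems by (intro Suc.IH) auto
    moreover have "t (Suc 0) \<le> t 0" using Suc.prems(1)[of 0] False by simp
    ultimately show ?thesis using eq by linarith
  qed (use Suc.prems(2)[of 0] in simp)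
qed simp

text \<open>Compares coefficients of w^(n+1) in S F = - w F'. The \<open>e n\<close> play the role
  of elementary symmetric functions of the reciprocal zeros, the coefficients of S that of their
  power sums.\<close>

lemma newton_identity:
  fixes F :: "real fps" and e :: "nat \<Rightarrow> real"
  assumes "\<And>n. fps_nth F n = (-1) ^ n * e n" "e 0 = 1"
  shows "fps_nth (neg_log_deriv F) (Suc n) =
    (\<Sum>j<n. (-1) ^ j * (e (Suc j) * fps_nth (neg_log_deriv F) (n - j))) + (-1) ^ n * (Suc n * e (Suc n))"
proof -
  define s where "s = fps_nth (neg_log_deriv F)"
  have "fps_nth (F * neg_log_deriv F) (Suc n) = fps_nth (- (fps_X * fps_deriv F)) (Suc n)"
    using neg_log_deriv_mult[of F] assms by (simp add: mult.commute)
  also have "\<dots> = (-1) ^ n * (Suc n * e (Suc n))"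
    by (simp add: assms)
  finally have "(\<Sum>j=0..Suc n. (-1) ^ j * e j * s (Suc n - j)) = (-1) ^ n * (Suc n * e (Suc n))"
    unfolding fps_mult_nth s_def assms(1) .
  also have "(\<Sum>j=0..Suc n. (-1) ^ j * e j * s (Suc n - j)) = (\<Sum>j<Suc (Suc n). (-1) ^ j * e j * s (Suc n - j))"
    by (simp add: atLeast0AtMost lessThan_Suc_atMost)
  also have "\<dots> = s (Suc n) + (\<Sum>j<Suc n. (-1) ^ Suc j * e (Suc j) * s (n - j))"
    by (subst sum.lessThan_Suc_shift) (simp add: assms)
  \<comment> \<open>The term j = n contains \<open>s 0 = 0\<close> and drops out.\<close>
  also have "\<dots> = s (Suc n) - (\<Sum>j<n. (-1) ^ j * (e (Suc j) * s (n - j)))"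
    by (simp add: s_def sum_negf mult.assoc)
  finally show ?thesis by (simp add: s_def)
qed

text \<open>Absorbs the integer factor in the last term of Newton's identity.\<close>

lemma two_mult_le_4_power: "2 * real (Suc (Suc n)) \<le> 4 ^ Suc n"
  by (induction n) auto

text \<open>If each term of Newton's alternating sum is at most half of its predecessor, then
  \<open>s (Suc n)\<close> is at least the first term minus the second, hence at least half of the
  first term \<open>d 0 * s n\<close>; iterating gives the geometric bound. The halving in turn
  needs \<open>s (Suc m) \<ge> d 0 / 2 * s m\<close> for smaller m, so both are proved in one strong
  induction.\<close>

lemma neg_log_deriv_ge_of_quarter_ratio:
  fixes F :: "real fps" and d :: "nat \<Rightarrow> real"
  assumes F0: "fps_nth F 0 = 1" and F: "\<And>n. fps_nth F (Suc n) = - d n * fps_nth F n"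
    and d: "\<And>n. 0 < d n" "\<And>n. d (Suc n) \<le> d n / 4"
  shows "(d 0 / 2) ^ Suc n \<le> fps_nth (neg_log_deriv F) (Suc n)"
proof -
  define e where "e n = (-1) ^ n * fps_nth F n" for n
  define s where "s = fps_nth (neg_log_deriv F)"
  have F_e: "fps_nth F n = (-1) ^ n * e n" for n
    by (simp add: e_def flip: power_mult_distrib mult.assoc)
  have e0: "e 0 = 1" and e_Suc: "e (Suc n) = d n * e n" for n
    by (simp_all add: e_def F0 F)
  have e_pos: "0 < e n" for n
    by (induction n) (simp_all add: e0 e_Suc d)
  have d_le: "d n \<le> d 0 / 4 ^ n" for n
  proof (induction n)
    case (Suc n)
    then show ?case using d(2)[of n] by simp
  qed simp
  have d_le': "d (Suc j) \<le> d 0 / 4" for j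
  proof -
    have "d 0 / 4 ^ Suc j \<le> d 0 / 4" using d(1)[of 0]
      by (intro divide_left_mono) auto
    then show ?thesis using d_le[of "Suc j"] by linarith
  qed
  have step: "d 0 / 2 * s n \<le> s (Suc n) \<and> 0 < s (Suc n)" if "0 < n" for n
    using that
  proof (induction n rule: less_induct)
    case (less n)
    have s1: "s 1 = d 0" using newton_identity[OF F_e e0, of 0] by (simp add: s_def e_Suc e0)
    have spos: "0 < s j" if "0 < j" "j \<le> n" for j
    proof (cases "j = 1")
      case False
      then show ?thesis using less.IH[of "j - 1"] that by auto
    qed (use s1 d in auto)
    \<comment> \<open>The last term of Newton's identity carries \<open>Suc n\<close> in place of a
      power sum; it is joined to the others to form one alternating sum of length
      \<open>Suc n\<close>.\<close>
    define t where "t j = (if j < n then e (Suc j) * s (n - j) else real (Suc n) * e (Suc n))" for j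
    have "s (Suc n) = (\<Sum>j<Suc n. (-1) ^ j * t j)"
      using newton_identity[OF F_e e0, of n] by (simp add: s_def t_def)
    also have "\<dots> = t 0 - (\<Sum>j<n. (-1) ^ j * t (Suc j))"
      unfolding sum.lessThan_Suc_shift by (simp add: sum_negf)
    finally have s_eq: "s (Suc n) = t 0 - (\<Sum>j<n. (-1) ^ j * t (Suc j))" .
    have t_pos: "0 < t j" if "j \<le> n" for j
      using that e_pos spos by (auto simp: t_def)
    have half: "t (Suc j) \<le> t j / 2" if "j < n" for j
    proof (cases "Suc j < n")
      case True
      \<comment> \<open>The ratio \<open>t (Suc j) / t j\<close> is \<open>d (Suc j)\<close> times
        \<open>s (n - Suc j) / s (n - j)\<close>. The first factor is at most
        \<open>d 0 / 4\<close>, the second at most \<open>2 / d 0\<close> by the induction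
        hypothesis.\<close>
      have "d 0 / 2 * s (n - Suc j) \<le> s (n - j)"
        using less.IH[of "n - Suc j"] True by (simp add: Suc_diff_Suc)
      then have "d 0 * s (n - Suc j) \<le> 2 * s (n - j)" by simp
      moreover have "d (Suc j) * s (n - Suc j) \<le> d 0 / 4 * s (n - Suc j)"
        using d_le' spos[of "n - Suc j"] True by (intro mult_right_mono) auto
      ultimately have "d (Suc j) * s (n - Suc j) \<le> s (n - j) / 2" by simp
      then have "e (Suc j) * (d (Suc j) * s (n - Suc j)) \<le> e (Suc j) * (s (n - j) / 2)"
        using e_pos[of "Suc j"] by (intro mult_left_mono) auto
      then show ?thesis using True by (simp add: t_def e_Suc algebra_simps)
    next
      case False
      then have n: "n = Suc j" using that by simp
      \<comment> \<open>The last pair compares \<open>Suc n * e (Suc n)\<close> with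
        \<open>e n * s 1\<close>. The bound \<open>d 0 / 4\<close> is too weak here once n > 1; the
        full decay \<open>d 0 / 4 ^ n\<close> beats the factor \<open>2 * Suc n\<close>.\<close>
      have "d n \<le> d 0 / 4 ^ n" by (rule d_le)
      then have "d n * 4 ^ n \<le> d 0" by (simp add: field_simps)
      moreover have "d n * (2 * real (Suc n)) \<le> d n * 4 ^ n"
        using two_mult_le_4_power[of j] d(1)[of n] n by (intro mult_left_mono) auto
      then have "2 * (real (Suc n) * d n) \<le> d n * 4 ^ n" by (simp only: mult_ac)
      ultimately have "real (Suc n) * d n \<le> s 1 / 2" using s1 by linarith
      then have "e n * (real (Suc n) * d n) \<le> e n * (s 1 / 2)"
        using e_pos[of n] by (intro mult_left_mono) auto
      then show ?thesis using n by (simp add: t_def e_Suc algebra_simps)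
    qed
    have "(\<Sum>j<n. (-1) ^ j * t (Suc j)) \<le> t (Suc 0)"
    proof -
      have "t (Suc (Suc j)) \<le> t (Suc j)" if "Suc j < n" for j
        using half[of "Suc j"] t_pos[of "Suc j"] that by linarith
      then show ?thesis
        using alternating_sum_bounds[of n "\<lambda>j. t (Suc j)"] less.prems t_pos by (auto simp: less_imp_le)
    qed
    then have "t 0 / 2 \<le> s (Suc n)" using s_eq half[of 0] less.prems by simp
    then show ?case using t_pos[of 0] less.prems by (simp add: t_def e_Suc e0)
  qed
  have "(d 0 / 2) ^ Suc n \<le> s (Suc n)" for n
  proof (induction n)
    case 0
    have "s 1 = d 0" using newton_identity[OF F_e e0, of 0] by (simp add: s_def e_Suc e0)
    then show ?case using d(1)[of 0] by simp
  next
    case (Suc n)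
    then have "(d 0 / 2) ^ Suc (Suc n) \<le> d 0 / 2 * s (Suc n)"
      using d(1)[of 0] mult_left_mono[OF Suc, of "d 0 / 2"] by simp
    then show ?case using step[of "Suc n"] by linarith
  qed
  then show ?thesis by (simp add: s_def)
qed

section \<open>Dilations F(p w) and q-difference equations\<close>

definition fps_dilate :: "real \<Rightarrow> real fps \<Rightarrow> real fps" where
  "fps_dilate p F = Abs_fps (\<lambda>n. p ^ n * fps_nth F n)"

lemma fps_dilate_nth [simp]: "fps_nth (fps_dilate p F) n = p ^ n * fps_nth F n"
  by (simp add: fps_dilate_def)

lemma fps_dilate_mult: "fps_dilate p (F * G) = fps_dilate p F * fps_dilate p G"
proof (rule fps_ext)
  fix n
  show "fps_nth (fps_dilate p (F * G)) n = fps_nth (fps_dilate p F * fps_dilate p G) n"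
    unfolding fps_dilate_nth fps_mult_nth sum_distrib_left
    by (intro sum.cong refl) (auto simp: algebra_simps simp flip: power_add)
qed

lemma fps_dilate_diff: "fps_dilate p (F - G) = fps_dilate p F - fps_dilate p G"
  by (simp add: fps_eq_iff algebra_simps)

lemma fps_dilate_1 [simp]: "fps_dilate p 1 = 1"
  by (simp add: fps_eq_iff)

lemma inverse_one_minus_rec:
  fixes V :: "'a::field fps"
  assumes "fps_nth V 0 = 0"
  shows "inverse (1 - V) = 1 + V * inverse (1 - V)"
  using inverse_mult_eq_1'[of "1 - V"] assms by (simp add: algebra_simps)

text \<open>The inverse is the geometric series in V, and its coefficient n involves V only up to n.
  Nonnegativity is assumed only that far, because the lemma is applied inside an induction that is
  still establishing the sign of V.\<close>

lemma inverse_one_minus_nth_nonneg: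
  fixes V :: "real fps"
  assumes "fps_nth V 0 = 0" "\<And>i. i \<le> n \<Longrightarrow> 0 \<le> fps_nth V i"
  shows "0 \<le> fps_nth (inverse (1 - V)) n"
  using assms(2)
proof (induction n rule: less_induct)
  case (less n)
  have "0 \<le> fps_nth V i * fps_nth (inverse (1 - V)) (n - i)" if "i \<le> n" for i
    using that less assms(1) by (cases "i = 0") auto
  then have "0 \<le> fps_nth (V * inverse (1 - V)) n"
    unfolding fps_mult_nth by (intro sum_nonneg) auto
  moreover have "0 \<le> fps_nth (1 :: real fps) n" by simp
  ultimately have "0 \<le> fps_nth (1 + V * inverse (1 - V)) n" unfolding fps_add_nth by linarith
  then show ?case using inverse_one_minus_rec[OF assms(1)] by simp
qed

text \<open>\<open>1 - V(w) = F(w) / F(p w)\<close> satisfies a Riccati equation coming from the second-order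
  \<open>q\<close>-difference equation of \<open>F\<close>.\<close>

lemma neg_log_deriv_ge_of_q_bessel:
  fixes F :: "real fps" and p c \<kappa> :: real
  assumes p: "0 < p" "p < 1" and c: "0 < c" "c < 1" and \<kappa>: "0 < \<kappa>"
    and F0: "fps_nth F 0 = 1"
    and F: "\<And>n. (1 - p ^ Suc n) * (1 - c * p ^ n) * fps_nth F (Suc n) = - (\<kappa> * p ^ n * fps_nth F n)"
  shows "(\<kappa> / (1 - c)) ^ Suc n \<le> fps_nth (neg_log_deriv F) (Suc n)"
proof -
  let ?T = "fps_dilate p"
  define V where "V = 1 - F * inverse (?T F)"
  \<comment> \<open>The reciprocal of the quotient 1 - V taken at p w, that is, F(p^2 w) / F(p
    w).\<close>
  define W where "W = inverse (1 - ?T V)"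
  define S where "S = neg_log_deriv F"
  have TF: "F = (1 - V) * ?T F"
    using inverse_mult_eq_1[of "?T F"] F0 by (simp add: V_def mult.assoc)
  have V0: "fps_nth V 0 = 0" by (simp add: V_def F0)
  have TF_ne: "?T F \<noteq> 0" using F0 by (metis fps_dilate_nth fps_nonzero_nth mult_1 power_0 zero_neq_one)
  have WV: "W * (1 - ?T V) = 1"
    unfolding W_def by (rule inverse_mult_eq_1) (simp add: V0)
  have "?T F = (1 - ?T V) * ?T (?T F)"
    using arg_cong[OF TF, of ?T] by (simp add: fps_dilate_mult fps_dilate_diff)
  then have TTF: "?T (?T F) = W * ?T F"
    using WV by (metis (no_types) mult.assoc mult_1)
  \<comment> \<open>The recurrence as a functional equation: the operator on the left multiplies the
    coefficient of w^n by 1 - (1 + c/p) p^n + (c/p) p^(2n) = (1 - p^n) (1 - c p^(n-1)).\<close>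
  have qdiff: "F - fps_const (1 + c / p) * ?T F + fps_const (c / p) * ?T (?T F)
      = - (fps_const \<kappa> * fps_X * ?T F)"
  proof (rule fps_ext)
    fix n
    show "fps_nth (F - fps_const (1 + c / p) * ?T F + fps_const (c / p) * ?T (?T F)) n
      = fps_nth (- (fps_const \<kappa> * fps_X * ?T F)) n"
    proof (cases n)
      case 0
      then show ?thesis using F0 by (simp add: mult.assoc)
    next
      case (Suc m)
      have "(1 - p ^ Suc m) * (1 - c * p ^ m) * fps_nth F (Suc m)
        = fps_nth (F - fps_const (1 + c / p) * ?T F + fps_const (c / p) * ?T (?T F)) n"
        using p Suc by (simp add: field_simps)
      then show ?thesis using F[of m] Suc by (simp add: mult.assoc)
    qed
  qed
  \<comment> \<open>Dividing the functional equation by F(p w) leaves a relation between V and W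
    alone.\<close>
  have "(1 - V - fps_const (1 + c / p) + fps_const (c / p) * W + fps_const \<kappa> * fps_X) * ?T F = 0"
    using qdiff unfolding TTF by (subst (asm) TF) (simp add: algebra_simps)
  then have "1 - V - fps_const (1 + c / p) + fps_const (c / p) * W + fps_const \<kappa> * fps_X = 0"
    using TF_ne by simp
  moreover have "fps_const (1 + c / p) = 1 + fps_const (c / p)"
    by (simp flip: fps_const_add)
  ultimately have "V = fps_const \<kappa> * fps_X + fps_const (c / p) * (W - 1)"
    by (simp add: algebra_simps del: fps_const_neg)
  also have "W - 1 = ?T V * W"
    using WV by (simp add: algebra_simps)
  finally have V_rec: "V = fps_const \<kappa> * fps_X + fps_const (c / p) * (?T V * W)" .
  have W0: "fps_nth W 0 = 1" by (simp add: W_def V0)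
  \<comment> \<open>The coefficient of index \<open>Suc n\<close> also occurs on the right of
    \<open>V_rec\<close>, as the top term of the convolution, with factor
    \<open>c * p ^ n < 1\<close>. Once it is moved to the left, the right-hand side involves V only
    up to index n, so nonnegativity propagates by induction.\<close>
  have V_Suc: "(1 - c * p ^ n) * fps_nth V (Suc n) = \<kappa> * fps_nth 1 n
      + c / p * (\<Sum>i<n. p ^ Suc i * fps_nth V (Suc i) * fps_nth W (n - i))" for n
  proof -
    have "fps_nth (?T V * W) (Suc n) = (\<Sum>i<Suc (Suc n). p ^ i * fps_nth V i * fps_nth W (Suc n - i))"
      by (simp add: fps_mult_nth atLeast0AtMost lessThan_Suc_atMost)
    also have "\<dots> = (\<Sum>i<n. p ^ Suc i * fps_nth V (Suc i) * fps_nth W (n - i)) + p ^ Suc n * fps_nth V (Suc n)"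
      by (subst sum.lessThan_Suc_shift) (simp add: V0 W0)
    finally have "fps_nth V (Suc n) = \<kappa> * fps_nth 1 n + c / p *
        ((\<Sum>i<n. p ^ Suc i * fps_nth V (Suc i) * fps_nth W (n - i)) + p ^ Suc n * fps_nth V (Suc n))"
      by (subst V_rec) (simp add: mult.assoc)
    then show ?thesis using p by (simp add: field_simps)
  qed
  have cp: "0 < 1 - c * p ^ n" for n
    using mult_power_less_one[of c p n] c p by simp
  have V_nonneg: "0 \<le> fps_nth V n" for n
  proof (induction n rule: less_induct)
    case (less n)
    show ?case
    proof (cases n)
      case 0
      then show ?thesis by (simp add: V0)
    next
      case (Suc m)
      have "0 \<le> fps_nth W j" if "j \<le> m" for j
        unfolding W_def using that Suc less p
        by (intro inverse_one_minus_nth_nonneg) (auto simp: V0)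
      then have "0 \<le> \<kappa> * fps_nth 1 m
          + c / p * (\<Sum>i<m. p ^ Suc i * fps_nth V (Suc i) * fps_nth W (m - i))"
        using Suc less p c \<kappa> by (intro add_nonneg_nonneg mult_nonneg_nonneg sum_nonneg) auto
      then show ?thesis using V_Suc[of m] cp[of m] Suc by (metis zero_le_mult_iff not_less)
    qed
  qed
  have V1: "fps_nth V 1 = \<kappa> / (1 - c)"
    using V_Suc[of 0] c by (simp add: field_simps)
  define b where "b = \<kappa> / (1 - c)"
  have b: "0 < b" using \<kappa> c by (simp add: b_def)
  let ?I = "inverse (1 - V)"
  have I_nonneg: "0 \<le> fps_nth ?I n" for n
    by (intro inverse_one_minus_nth_nonneg V0 V_nonneg)
  have I_ge: "b ^ n \<le> fps_nth ?I n" for n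
  proof (induction n)
    case 0
    then show ?case by (simp add: V0)
  next
    case (Suc n)
    have "b ^ Suc n \<le> fps_nth V 1 * fps_nth ?I n"
      using Suc b V1 by (simp add: b_def[symmetric])
    also have "\<dots> \<le> (\<Sum>i=0..Suc n. fps_nth V i * fps_nth ?I (Suc n - i))"
      using member_le_sum[of 1 "{0..Suc n}" "\<lambda>i. fps_nth V i * fps_nth ?I (Suc n - i)"] V_nonneg I_nonneg
      by simp
    also have "\<dots> = fps_nth ?I (Suc n)"
      by (subst (2) inverse_one_minus_rec[OF V0]) (simp add: fps_mult_nth)
    finally show ?case .
  qed
  define D where "D = fps_X * fps_deriv V"
  have D_nonneg: "0 \<le> fps_nth D n" for n
    using V_nonneg by (cases n) (simp_all add: D_def)
  \<comment> \<open>The logarithmic derivative of F(w) = (1 - V(w)) F(p w): the first factor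
    contributes w V' / (1 - V), the second the dilate of S.\<close>
  have "neg_log_deriv F = D * ?I + ?T S"
  proof (rule neg_log_deriv_unique)
    have I: "?I * (1 - V) = 1" by (rule inverse_mult_eq_1) (simp add: V0)
    have "?T S * ?T F = ?T (S * F)" by (simp add: fps_dilate_mult)
    also have "S * F = - (fps_X * fps_deriv F)" by (simp add: S_def neg_log_deriv_mult F0)
    also have "?T (- (fps_X * fps_deriv F)) = - (fps_X * fps_deriv (?T F))"
    proof (rule fps_ext)
      fix n
      show "fps_nth (?T (- (fps_X * fps_deriv F))) n = fps_nth (- (fps_X * fps_deriv (?T F))) n"
        by (cases n) simp_all
    qed
    finally have TS: "?T S * ?T F = - (fps_X * fps_deriv (?T F))" .
    have "(D * ?I + ?T S) * F = D * (?I * (1 - V)) * ?T F + (1 - V) * (?T S * ?T F)"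
      by (subst TF) (simp only: algebra_simps)
    also have "\<dots> = D * ?T F - (1 - V) * fps_X * fps_deriv (?T F)"
      unfolding I TS by simp
    also have "\<dots> = - (fps_X * fps_deriv ((1 - V) * ?T F))"
      by (simp add: D_def algebra_simps)
    finally show "(D * ?I + ?T S) * F = - (fps_X * fps_deriv F)" unfolding TF[symmetric] .
  qed (simp add: F0)
  then have S_rec: "S = D * ?I + ?T S" by (simp add: S_def)
  have "b ^ Suc n \<le> fps_nth S (Suc n)" for n
  proof -
    \<comment> \<open>Of the convolution of nonnegative coefficients only the term with index 1 of D
      is kept; it equals the coefficient \<open>b\<close> of V.\<close>
    have "b ^ Suc n \<le> fps_nth D 1 * fps_nth ?I n"
      using I_ge[of n] b V1 by (simp add: b_def[symmetric] D_def)
    also have "\<dots> \<le> fps_nth (D * ?I) (Suc n)"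
      using member_le_sum[of 1 "{0..Suc n}" "\<lambda>i. fps_nth D i * fps_nth ?I (Suc n - i)"] D_nonneg I_nonneg
      by (simp add: fps_mult_nth)
    also have "\<dots> = (1 - p ^ Suc n) * fps_nth S (Suc n)"
      using arg_cong[OF S_rec, of "\<lambda>A. fps_nth A (Suc n)"] by (simp add: algebra_simps)
    finally have *: "b ^ Suc n \<le> (1 - p ^ Suc n) * fps_nth S (Suc n)" .
    have "p ^ Suc n < 1" using p by (intro power_less_one_iff[THEN iffD2]) auto
    then have "0 < 1 - p ^ Suc n" by simp
    moreover have "0 < b ^ Suc n" using b by simp
    ultimately have "0 < fps_nth S (Suc n)" using * by (smt (verit) mult_nonneg_nonpos)
    moreover have "0 < p ^ Suc n" using p by simp
    ultimately have "0 \<le> p ^ Suc n * fps_nth S (Suc n)" by simp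
    then show ?thesis using * by (simp add: algebra_simps)
  qed
  then show ?thesis by (simp add: S_def b_def)
qed

section \<open>Entire functions with positive logarithmic derivative\<close>

text \<open>The coefficient inequalities live over the reals, whereas zeros and convergence are
  studied in the complex plane; this embedding connects the two.\<close>

definition complex_fps :: "real fps \<Rightarrow> complex fps" where
  "complex_fps A = Abs_fps (\<lambda>n. of_real (fps_nth A n))"

lemma complex_fps_nth [simp]: "fps_nth (complex_fps A) n = of_real (fps_nth A n)"
  by (simp add: complex_fps_def)

lemma complex_fps_mult: "complex_fps (A * B) = complex_fps A * complex_fps B"
  by (simp add: fps_eq_iff fps_mult_nth)

lemma complex_fps_minus: "complex_fps (- A) = - complex_fps A"
  by (simp add: fps_eq_iff)

lemma complex_fps_deriv: "complex_fps (fps_deriv A) = fps_deriv (complex_fps A)"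
  by (simp add: fps_eq_iff)

lemma complex_fps_X: "complex_fps fps_X = fps_X"
  by (simp add: fps_eq_iff fps_X_def)

lemma fps_conv_radius_complex_fps [simp]: "fps_conv_radius (complex_fps A) = fps_conv_radius A"
proof -
  have "conv_radius (\<lambda>n. norm (complex_of_real (fps_nth A n))) = conv_radius (\<lambda>n. norm (fps_nth A n))"
    by simp
  then show ?thesis unfolding fps_conv_radius_def conv_radius_norm by simp
qed

lemma eval_complex_fps_of_real:
  assumes "ereal \<bar>x\<bar> < fps_conv_radius A"
  shows "eval_fps (complex_fps A) (of_real x) = of_real (eval_fps A x)"
proof -
  have "(\<lambda>n. fps_nth A n * x ^ n) sums eval_fps A x"
    using assms by (intro sums_eval_fps) simp
  from sums_of_real[OF this, where 'a = complex] show ?thesis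
    by (simp add: eval_fps_def sums_iff)
qed

lemma norm_eval_complex_fps_le:
  assumes "\<And>n. 0 \<le> fps_nth A n" "ereal (norm z) < fps_conv_radius A"
  shows "norm (eval_fps (complex_fps A) z) \<le> eval_fps A (norm z)"
proof -
  have "summable (\<lambda>n. norm (fps_nth (complex_fps A) n * z ^ n))"
    using assms by (intro norm_summable_fps) simp
  then have "norm (eval_fps (complex_fps A) z) \<le> (\<Sum>n. norm (fps_nth (complex_fps A) n * z ^ n))"
    unfolding eval_fps_def by (rule summable_norm)
  then show ?thesis using assms by (simp add: eval_fps_def norm_mult norm_power)
qed

lemma neg_log_deriv_complex_fps:
  assumes "fps_nth F 0 \<noteq> 0"
  shows "neg_log_deriv (complex_fps F) = complex_fps (neg_log_deriv F)"
proof (rule neg_log_deriv_unique)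
  show "complex_fps (neg_log_deriv F) * complex_fps F = - (fps_X * fps_deriv (complex_fps F))"
    using arg_cong[OF neg_log_deriv_mult[OF assms], of complex_fps]
    by (simp add: complex_fps_mult complex_fps_minus complex_fps_deriv complex_fps_X)
qed (use assms in simp)

text \<open>Where F has no zeros, 1/F is holomorphic, so its Taylor series at 0 converges there.
  This yields a positive radius near 0 and, read backwards, a zero of F in the closed disk of
  convergence.\<close>

lemma fps_conv_radius_neg_log_deriv:
  fixes F :: "complex fps"
  assumes "fps_conv_radius F = \<infinity>" "0 < r" "\<And>z. ereal (norm z) < r \<Longrightarrow> eval_fps F z \<noteq> 0"
  shows "r \<le> fps_conv_radius (neg_log_deriv F)"
proof -
  have "fps_conv_radius (fps_X * fps_deriv F) = \<infinity>"
    using fps_conv_radius_mult[of fps_X "fps_deriv F"] fps_conv_radius_deriv[of F] assms(1)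
    by simp
  moreover have "r \<le> fps_conv_radius (inverse F)"
    using fps_conv_radius_inverse[where f = F and r = r] assms by (simp add: zero_ereal_def)
  ultimately show ?thesis
    using fps_conv_radius_mult[of "fps_X * fps_deriv F" "inverse F"]
    by (simp add: neg_log_deriv_def)
qed

text \<open>An entire function with \<open>- w F'(w) / F(w) = \<Sum> s\<^sub>n w\<^sup>n\<close> and \<open>s\<^sub>n \<ge> \<beta>\<^sup>n\<close> for \<open>n \<ge> 1\<close>. When \<open>F\<close> is a canonical
  product, \<open>s\<^sub>n\<close> is the sum of the \<open>n\<close>-th powers of the reciprocals of its zeros.\<close>

locale positive_log_deriv =
  fixes F :: "real fps" and \<beta> :: real
  assumes F0: "fps_nth F 0 = 1"
    and entire: "fps_conv_radius F = \<infinity>"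
    and \<beta>: "0 < \<beta>"
    and S_ge: "\<And>n. \<beta> ^ Suc n \<le> fps_nth (neg_log_deriv F) (Suc n)"
begin

definition S where "S = neg_log_deriv F"
text \<open>The power series of -log F. At n = 0 the quotient is 0 / 0 = 0, the correct constant
  term because F(0) = 1.\<close>

definition P where "P = Abs_fps (\<lambda>n. fps_nth S n / of_nat n)"
text \<open>The conversion to a real loses nothing, since the radius turns out to be positive and
  finite (\<open>conv_radius_S\<close>).\<close>

definition R where "R = real_of_ereal (fps_conv_radius S)"

abbreviation \<Phi> where "\<Phi> \<equiv> eval_fps (complex_fps F)"
abbreviation \<Psi> where "\<Psi> \<equiv> eval_fps (complex_fps S)"

lemma S_0 [simp]: "fps_nth S 0 = 0"
  by (simp add: S_def)

lemma S_pos: "0 < fps_nth S (Suc n)"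
  using less_le_trans[OF zero_less_power[OF \<beta>] S_ge] by (simp add: S_def)

lemma S_nonneg: "0 \<le> fps_nth S n"
  using S_pos[of "n - 1"] by (cases n) auto

lemma neg_log_deriv_cF: "neg_log_deriv (complex_fps F) = complex_fps S"
  by (simp add: neg_log_deriv_complex_fps F0 S_def)

lemma \<Phi>_holomorphic: "\<Phi> holomorphic_on A"
  using entire by (intro holomorphic_intros) auto

lemma \<Phi>_continuous: "isCont \<Phi> z"
  using \<Phi>_holomorphic[of UNIV] holomorphic_on_imp_continuous_on continuous_on_eq_continuous_at by blast

lemma \<Phi>_0 [simp]: "\<Phi> 0 = 1"
  by (simp add: eval_fps_at_0 F0)

section \<open>The disk of convergence of S and the first zero of F\<close>

lemma conv_radius_S_pos: "0 < fps_conv_radius S"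
proof -
  obtain r where r: "0 < r" "\<And>z. dist 0 z < r \<Longrightarrow> \<Phi> z \<noteq> 0"
    using continuous_at_avoid[OF \<Phi>_continuous, of 0 0] by auto
  have "ereal r \<le> fps_conv_radius (neg_log_deriv (complex_fps F))"
    using r entire by (intro fps_conv_radius_neg_log_deriv) auto
  then show ?thesis using r
    by (metis fps_conv_radius_complex_fps neg_log_deriv_cF ereal_less(2) less_le_trans)
qed

text \<open>At w = 1/\<beta> every term from index 1 on is at least 1, so the series diverges. Here
  the geometric lower bound on the coefficients forces a finite radius, and thereby the existence of
  a zero.\<close>

lemma conv_radius_S_le: "fps_conv_radius S \<le> ereal (1 / \<beta>)"
proof -
  have "\<not> (\<lambda>n. norm (fps_nth S n * (1 / \<beta>) ^ n)) \<longlonglongrightarrow> 0"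
  proof
    assume "(\<lambda>n. norm (fps_nth S n * (1 / \<beta>) ^ n)) \<longlonglongrightarrow> 0"
    then have lim: "(\<lambda>n. norm (fps_nth S (Suc n) * (1 / \<beta>) ^ Suc n)) \<longlonglongrightarrow> 0"
      by (rule LIMSEQ_Suc)
    have "1 \<le> norm (fps_nth S (Suc n) * (1 / \<beta>) ^ Suc n)" for n
    proof -
      have "\<beta> ^ Suc n * (1 / \<beta>) ^ Suc n \<le> fps_nth S (Suc n) * (1 / \<beta>) ^ Suc n"
        using S_ge \<beta> by (intro mult_right_mono) (auto simp: S_def)
      moreover have "\<beta> ^ Suc n * (1 / \<beta>) ^ Suc n = 1"
        using \<beta> by (simp flip: power_mult_distrib)
      ultimately show ?thesis unfolding real_norm_def by linarith
    qed
    then have "1 \<le> (0::real)" by (intro LIMSEQ_le_const[OF lim]) auto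
    then show False by simp
  qed
  then have "\<not> summable (\<lambda>n. norm (fps_nth S n * (1 / \<beta>) ^ n))"
    using summable_LIMSEQ_zero by blast
  from conv_radius_leI[OF this] show ?thesis using \<beta> by (simp add: fps_conv_radius_def)
qed

lemma conv_radius_S: "fps_conv_radius S = ereal R"
  using conv_radius_S_pos conv_radius_S_le unfolding R_def
  by (cases "fps_conv_radius S") auto

lemma R_pos: "0 < R"
  using conv_radius_S_pos conv_radius_S by simp

lemma deriv_P: "fps_deriv P = fps_shift 1 S"
  by (simp add: fps_eq_iff P_def)

lemma P_nonneg: "0 \<le> fps_nth P n"
  by (simp add: P_def S_nonneg)

lemma P_le: "fps_nth P n \<le> fps_nth S n"
proof (cases n)
  case (Suc m)
  have "fps_nth S n / real n \<le> fps_nth S n / 1"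
    using Suc S_nonneg by (intro divide_left_mono) auto
  then show ?thesis by (simp add: P_def)
qed (simp add: P_def)

lemma conv_radius_P: "ereal R \<le> fps_conv_radius P"
  unfolding fps_conv_radius_def
proof (rule conv_radius_geI_ex')
  fix r assume r: "0 < r" "ereal r < ereal R"
  have "summable (\<lambda>n. fps_nth S n * r ^ n)"
    using r conv_radius_S by (intro summable_fps) simp
  then show "summable (\<lambda>n. fps_nth P n * of_real r ^ n)"
  proof (rule summable_comparison_test')
    fix n :: nat
    show "norm (fps_nth P n * of_real r ^ n) \<le> fps_nth S n * r ^ n"
      using r P_nonneg[of n] P_le[of n] by (simp add: abs_mult mult_right_mono)
  qed
qed

lemma P_radius: "norm z < R \<Longrightarrow> ereal (norm z) < fps_conv_radius P"
  using conv_radius_P by (meson ereal_less_eq(3) less_ereal.simps(1) less_le_trans)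

lemma z_deriv_\<Phi>:
  assumes "norm z < R"
  shows "z * deriv \<Phi> z = - (\<Psi> z * \<Phi> z)"
proof -
  have *: "complex_fps S * complex_fps F = - (fps_X * fps_deriv (complex_fps F))"
    using neg_log_deriv_mult[of "complex_fps F"] F0 neg_log_deriv_cF by simp
  have r: "fps_conv_radius (fps_deriv (complex_fps F)) = \<infinity>"
    using fps_conv_radius_deriv[of "complex_fps F"] entire by simp
  have "\<Psi> z * \<Phi> z = eval_fps (complex_fps S * complex_fps F) z"
    using assms entire by (subst eval_fps_mult) (auto simp: conv_radius_S)
  also have "\<dots> = - (z * eval_fps (fps_deriv (complex_fps F)) z)"
    unfolding * using fps_conv_radius_mult[of fps_X "fps_deriv (complex_fps F)"]
    by (simp add: eval_fps_minus eval_fps_mult r)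
  also have "eval_fps (fps_deriv (complex_fps F)) z = deriv \<Phi> z"
    using entire by (intro eval_fps_deriv) simp
  finally show ?thesis by simp
qed

text \<open>Since P' = S/w = - F'/F, the product F exp(P) has derivative zero on the disk and keeps
  its value 1 at the origin.\<close>

lemma \<Phi>_eq_exp:
  assumes "norm z < R"
  shows "\<Phi> z = exp (- eval_fps (complex_fps P) z)"
proof -
  let ?p = "eval_fps (complex_fps P)"
  have rP: "ereal (norm w) < fps_conv_radius (complex_fps P)" if "norm w < R" for w :: complex
    using that P_radius by simp
  have dP: "(?p has_field_derivative eval_fps (complex_fps (fps_shift 1 S)) w) (at w)"
    if "norm w < R" for w
    using has_field_derivative_eval_fps[OF rP[OF that]]
    by (simp add: deriv_P flip: complex_fps_deriv)
  have d\<Phi>: "(\<Phi> has_field_derivative - (eval_fps (complex_fps (fps_shift 1 S)) w * \<Phi> w)) (at w)"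
    if "norm w < R" for w
  proof -
    \<comment> \<open>The division of S F = - w F' by w is carried out on formal series, so that the
      result also holds at w = 0.\<close>
    have "complex_fps (fps_shift 1 S) * complex_fps F = - fps_deriv (complex_fps F)"
    proof -
      have "S = fps_X * fps_shift 1 S"
        by (rule fps_ext, rename_tac n, case_tac n) simp_all
      then have "complex_fps S = fps_X * complex_fps (fps_shift 1 S)"
        by (metis complex_fps_mult complex_fps_X)
      then have "fps_X * (complex_fps (fps_shift 1 S) * complex_fps F) = fps_X * (- fps_deriv (complex_fps F))"
        using neg_log_deriv_mult[of "complex_fps F"] F0 neg_log_deriv_cF by (simp add: mult.assoc)
      then show ?thesis by (metis fps_X_neq_zero mult_left_cancel)
    qed
    then have "eval_fps (complex_fps (fps_shift 1 S) * complex_fps F) w = eval_fps (- fps_deriv (complex_fps F)) w"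
      by simp
    moreover have "fps_conv_radius (fps_deriv (complex_fps F)) = \<infinity>"
      using fps_conv_radius_deriv[of "complex_fps F"] entire by simp
    ultimately have "eval_fps (complex_fps (fps_shift 1 S)) w * \<Phi> w = - eval_fps (fps_deriv (complex_fps F)) w"
      using that entire by (simp add: eval_fps_mult eval_fps_minus conv_radius_S)
    then show ?thesis
      using has_field_derivative_eval_fps[of w "complex_fps F"] entire by simp
  qed
  have "((\<lambda>w. \<Phi> w * exp (?p w)) has_field_derivative 0) (at w within ball 0 R)" if "w \<in> ball 0 R" for w
  proof -
    have "norm w < R" using that by simp
    from DERIV_mult[OF d\<Phi>[OF this] DERIV_fun_exp[OF dP[OF this]]]
    have "((\<lambda>w. \<Phi> w * exp (?p w)) has_field_derivative 0) (at w)"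
      by (simp add: algebra_simps)
    then show ?thesis by (rule has_field_derivative_at_within)
  qed
  then have "\<exists>c. \<forall>w\<in>ball 0 R. \<Phi> w * exp (?p w) = c"
    by (intro has_field_derivative_zero_constant) auto
  then obtain c where c: "\<And>w. norm w < R \<Longrightarrow> \<Phi> w * exp (?p w) = c" by auto
  have "\<Phi> z * exp (?p z) = 1" using c[OF assms] c[of 0] R_pos by (simp add: eval_fps_at_0 P_def F0)
  then show ?thesis by (simp add: exp_minus field_simps)
qed

lemma \<Phi>_nonzero: "norm z < R \<Longrightarrow> \<Phi> z \<noteq> 0"
  by (simp add: \<Phi>_eq_exp)

text \<open>The lower bound is F(|z|). It holds because |exp(-P(z))| = exp(-Re P(z)), and Re P(z) is
  at most P(|z|) when P has nonnegative coefficients.\<close>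

lemma norm_\<Phi>_ge:
  assumes "norm z < R"
  shows "exp (- eval_fps P (norm z)) \<le> norm (\<Phi> z)"
proof -
  have "norm (eval_fps (complex_fps P) z) \<le> eval_fps P (norm z)"
    using assms P_radius by (intro norm_eval_complex_fps_le P_nonneg) auto
  then have "Re (eval_fps (complex_fps P) z) \<le> eval_fps P (norm z)"
    using complex_Re_le_cmod order_trans by blast
  then show ?thesis using assms by (simp add: \<Phi>_eq_exp norm_exp_eq_Re)
qed

lemma \<Phi>_of_real:
  assumes "\<bar>x\<bar> < R"
  shows "\<Phi> (of_real x) = of_real (exp (- eval_fps P x))"
  using assms P_radius[of x] by (simp add: \<Phi>_eq_exp eval_complex_fps_of_real exp_of_real[symmetric])

text \<open>A Pringsheim argument: there is a zero on the circle of convergence, and \<open>|F(w)| \<ge> F(|w|)\<close>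
  moves it to the positive axis.\<close>

lemma \<Phi>_R: "\<Phi> (of_real R) = 0"
proof -
  \<comment> \<open>If the closed disk were free of zeros, compactness would give a zero-free disk
    of radius R + e; S would converge there, contradicting the meaning of R.\<close>
  have "\<exists>z. norm z \<le> R \<and> \<Phi> z = 0"
  proof (rule ccontr)
    assume "\<not> ?thesis"
    then have nz: "\<Phi> z \<noteq> 0" if "z \<in> cball 0 R" for z using that by auto
    have "open {z. \<Phi> z \<noteq> 0}"
      using \<Phi>_continuous by (intro open_Collect_neq) (auto simp: continuous_on_eq_continuous_at)
    moreover have "cball 0 R \<subseteq> {z. \<Phi> z \<noteq> 0}" using nz by auto
    ultimately obtain e where e: "0 < e" "(\<Union>x\<in>cball 0 R. ball x e) \<subseteq> {z. \<Phi> z \<noteq> 0}"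
      using compact_subset_open_imp_ball_epsilon_subset[OF compact_cball] by metis
    have "\<Phi> z \<noteq> 0" if "norm z < R + e" for z
    proof (cases "norm z \<le> R")
      case False
      then have "z \<noteq> 0" using R_pos by auto
      \<comment> \<open>The radial projection of z onto the circle of radius R.\<close>
      define w where "w = of_real (R / norm z) * z"
      have "norm w = R" using False R_pos by (cases "z = 0") (auto simp: w_def norm_mult norm_divide)
      moreover have "dist w z < e"
      proof -
        have "w - z = of_real (R / norm z - 1) * z" by (simp add: w_def algebra_simps)
        then have "dist w z = \<bar>R / norm z - 1\<bar> * norm z"
          by (metis dist_norm norm_mult norm_of_real)
        also have "\<dots> = norm z - R" using False R_pos \<open>z \<noteq> 0\<close> by (simp add: abs_if field_simps)
        finally show ?thesis using that by simp
      qed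
      ultimately show ?thesis using e(2) by (fastforce simp: dist_commute)
    qed (use nz in auto)
    then have "ereal (R + e) \<le> fps_conv_radius (neg_log_deriv (complex_fps F))"
      using entire R_pos e by (intro fps_conv_radius_neg_log_deriv) auto
    then show False using e by (simp add: neg_log_deriv_cF conv_radius_S)
  qed
  then obtain z where z: "norm z = R" "\<Phi> z = 0" using \<Phi>_nonzero by force
  \<comment> \<open>The lower bound on |F| is available only in the open disk, so both z and R are
    approached from inside along scaling factors tending to 1.\<close>
  define r where "r n = 1 - 1 / (real n + 2)" for n
  have r: "r \<longlonglongrightarrow> 1" unfolding r_def by real_asymp
  have r01: "0 < r n" "r n < 1" for n by (auto simp: r_def field_simps)
  have lim: "(\<lambda>n. \<Phi> (of_real (r n) * w)) \<longlonglongrightarrow> \<Phi> w" for w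
  proof (rule isCont_tendsto_compose[OF \<Phi>_continuous])
    show "(\<lambda>n. of_real (r n) * w) \<longlonglongrightarrow> w"
      using tendsto_mult_right[OF tendsto_of_real[OF r], of w] by simp
  qed
  have "norm (\<Phi> (of_real (r n) * of_real R)) \<le> norm (\<Phi> (of_real (r n) * z))" for n
  proof -
    have "norm (of_real (r n) * z) = r n * R" using z r01[of n] by (simp add: norm_mult)
    moreover have "r n * R < R" "0 \<le> r n * R" using r01[of n] R_pos by auto
    ultimately show ?thesis
      using norm_\<Phi>_ge[of "of_real (r n) * z"] \<Phi>_of_real[of "r n * R"] by simp
  qed
  moreover have "(\<lambda>n. norm (\<Phi> (of_real (r n) * z))) \<longlonglongrightarrow> norm (0::complex)"
    using tendsto_norm[OF lim[of z]] z by simp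
  moreover have "(\<lambda>n. norm (\<Phi> (of_real (r n) * of_real R))) \<longlonglongrightarrow> norm (\<Phi> (of_real R))"
    by (intro tendsto_norm lim)
  ultimately have "norm (\<Phi> (of_real R)) \<le> norm (0::complex)"
    by (intro LIMSEQ_le) auto
  then show ?thesis by simp
qed

section \<open>Growth of S on the positive axis, radii of starlikeness and zero equations\<close>

lemma norm_\<Psi>_le: "norm z < R \<Longrightarrow> norm (\<Psi> z) \<le> eval_fps S (norm z)"
  by (intro norm_eval_complex_fps_le S_nonneg) (simp add: conv_radius_S)

lemma \<Psi>_of_real: "\<bar>x\<bar> < R \<Longrightarrow> \<Psi> (of_real x) = of_real (eval_fps S x)"
  by (intro eval_complex_fps_of_real) (simp add: conv_radius_S)

lemma eval_S_strict_mono: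
  assumes "0 \<le> x" "x < y" "y < R"
  shows "eval_fps S x < eval_fps S y"
proof -
  have sm: "summable (\<lambda>n. fps_nth S n * x ^ n)" "summable (\<lambda>n. fps_nth S n * y ^ n)"
    using assms by (auto intro!: summable_fps simp: conv_radius_S)
  have "0 < (\<Sum>n. fps_nth S n * y ^ n - fps_nth S n * x ^ n)"
  proof (rule suminf_pos2[where i = 1])
    show "0 \<le> fps_nth S n * y ^ n - fps_nth S n * x ^ n" for n
      using assms S_nonneg by (simp add: mult_left_mono power_mono)
    show "0 < fps_nth S 1 * y ^ 1 - fps_nth S 1 * x ^ 1"
      using assms S_pos[of 0] by simp
  qed (intro summable_diff sm)
  then show ?thesis unfolding eval_fps_def suminf_diff[OF sm(2,1), symmetric] by simp
qed

text \<open>If S were bounded by t on (0, R), then P would be too, as its coefficients are dominated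
  by those of S; F(x) = exp(-P(x)) would stay above exp(-t), contradicting F(R) = 0.\<close>

lemma eval_S_unbounded: "\<exists>x. 0 < x \<and> x < R \<and> t < eval_fps S x"
proof (rule ccontr)
  assume "\<not> ?thesis"
  then have le: "eval_fps S x \<le> t" if "0 < x" "x < R" for x using that by force
  have "exp (- t) \<le> norm (\<Phi> (of_real x))" if "0 < x" "x < R" for x
  proof -
    have "eval_fps P x \<le> eval_fps S x"
      unfolding eval_fps_def using that P_le P_radius[of x]
      by (intro suminf_le mult_right_mono summable_fps) (auto simp: conv_radius_S)
    then have "exp (- t) \<le> exp (- eval_fps P x)" using le[OF that] by simp
    then show ?thesis using that \<Phi>_of_real[of x] by simp
  qed
  then have "\<forall>\<^sub>F x in at_left R. exp (- t) \<le> norm (\<Phi> (of_real x))"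
    using eventually_at_left[of 0 R] R_pos by auto
  moreover have "((\<lambda>x. norm (\<Phi> (of_real x))) \<longlongrightarrow> norm (\<Phi> (of_real R))) (at_left R)"
    by (intro tendsto_norm isCont_tendsto_compose[OF \<Phi>_continuous] tendsto_intros)
  ultimately have "exp (- t) \<le> norm (\<Phi> (of_real R))"
    by (intro tendsto_lowerbound) auto
  then show False by (simp add: \<Phi>_R)
qed

lemma eval_S_surj:
  assumes "0 < t"
  obtains x where "0 < x" "x < R" "eval_fps S x = t"
proof -
  obtain b where b: "0 < b" "b < R" "t < eval_fps S b" using eval_S_unbounded by blast
  have "continuous_on {0..b} (eval_fps S)"
    using b by (intro continuous_on_eval_fps') (auto simp: conv_radius_S)
  moreover have "eval_fps S 0 = 0" by (simp add: eval_fps_at_0)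
  ultimately obtain x where x: "0 \<le> x" "x \<le> b" "eval_fps S x = t"
    using IVT'[of "eval_fps S" 0 t b] b assms by auto
  then have "x \<noteq> 0" using assms \<open>eval_fps S 0 = 0\<close> by auto
  with x b show ?thesis by (intro that[of x]) auto
qed

text \<open>Treats all three functions at once through z f'/f = 1 - k S(z^m); \<open>\<rho>\<close>
  is the modulus at which z^m reaches the first zero of F. For |z| < y the real part is at least 1 -
  k S(|z|^m), which exceeds 1 - k S(y^m) = \<alpha> by monotonicity.\<close>

lemma starlike_radius_eq:
  assumes y: "0 < y" "y < \<rho>" "\<rho> ^ m = R" "0 < m" and k: "0 < k" "k * eval_fps S (y ^ m) = 1 - \<alpha>"
    and \<alpha>: "\<alpha> < 1"
    and D: "ball 0 \<rho> \<subseteq> D"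
    and f: "\<And>z. z \<noteq> 0 \<Longrightarrow> norm z < \<rho> \<Longrightarrow> f z \<noteq> 0"
      "\<And>z. z \<noteq> 0 \<Longrightarrow> norm z < \<rho> \<Longrightarrow> z * deriv f z / f z = 1 - of_real k * \<Psi> (z ^ m)"
  shows "starlike_radius D f \<alpha> = ereal y"
proof -
  let ?A = "{r. 0 < r \<and> ball 0 r \<subseteq> D \<and> (\<forall>z\<in>ball 0 r - {0}. f z \<noteq> 0) \<and>
    (\<forall>z\<in>ball 0 r. Re (starlike_quot f z) > \<alpha>)}"
  have pow_less: "r ^ m < R" if "0 \<le> r" "r < \<rho>" for r
    using that y power_strict_mono[of r \<rho> m] by simp
  have "Re (starlike_quot f z) > \<alpha>" if "norm z < y" for z
  proof (cases "z = 0")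
    case False
    have "eval_fps S (norm z ^ m) < eval_fps S (y ^ m)"
      using that y pow_less[of y] by (intro eval_S_strict_mono power_strict_mono) auto
    moreover have "Re (\<Psi> (z ^ m)) \<le> eval_fps S (norm z ^ m)"
      using norm_\<Psi>_le[of "z ^ m"] complex_Re_le_cmod[of "\<Psi> (z ^ m)"] pow_less[of "norm z"] that y
      by (simp add: norm_power)
    ultimately have "Re (\<Psi> (z ^ m)) < eval_fps S (y ^ m)" by simp
    then have "k * Re (\<Psi> (z ^ m)) < 1 - \<alpha>"
      using k by (metis mult_strict_left_mono)
    then show ?thesis using f(2)[of z] False that y by (simp add: starlike_quot_def)
  qed (use \<alpha> in \<open>simp add: starlike_quot_def\<close>)
  then have "y \<in> ?A" using y D f(1) by (auto simp: subset_iff)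
  moreover have "r \<le> y" if "r \<in> ?A" for r
  proof (rule ccontr)
    assume "\<not> r \<le> y"
    \<comment> \<open>A larger disk contains the point y itself, where the quotient equals \<alpha>
      exactly.\<close>
    then have "Re (starlike_quot f (of_real y)) > \<alpha>" using that y by auto
    moreover have "\<Psi> (of_real y ^ m) = of_real (eval_fps S (y ^ m))"
      using \<Psi>_of_real[of "y ^ m"] y pow_less[of y] by simp
    ultimately show False using f(2)[of "of_real y"] y k by (simp add: starlike_quot_def)
  qed
  ultimately show ?thesis
    unfolding starlike_radius_def by (intro antisym Sup_least Sup_upper) auto
qed

lemma \<Phi>_square_deriv:
  "((\<lambda>z. C * \<Phi> (z\<^sup>2)) has_field_derivative C * (2 * z * deriv \<Phi> (z\<^sup>2))) (at z)"
proof -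
  have "(\<Phi> has_field_derivative deriv \<Phi> (z\<^sup>2)) (at (z\<^sup>2))"
    using \<Phi>_holomorphic[of UNIV] by (rule holomorphic_derivI) auto
  moreover have "((\<lambda>z. z\<^sup>2) has_field_derivative 2 * z) (at z)"
    by (auto intro!: derivative_eq_intros)
  ultimately have "((\<lambda>z. \<Phi> (z\<^sup>2)) has_field_derivative deriv \<Phi> (z\<^sup>2) * (2 * z)) (at z)"
    by (rule DERIV_chain2)
  from DERIV_cmult[OF this, of C] show ?thesis by (simp only: mult_ac)
qed

lemma z_deriv_\<Phi>_square:
  assumes "norm z < sqrt R"
  shows "z * deriv (\<lambda>z. C * \<Phi> (z\<^sup>2)) z = - 2 * \<Psi> (z\<^sup>2) * (C * \<Phi> (z\<^sup>2))"
proof -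
  have "(norm z)\<^sup>2 < (sqrt R)\<^sup>2" using assms by (intro power_strict_mono) auto
  then have "norm (z\<^sup>2) < R" using R_pos by (simp add: norm_power)
  from z_deriv_\<Phi>[OF this] show ?thesis
    unfolding DERIV_imp_deriv[OF \<Phi>_square_deriv]
    by (simp add: power2_eq_square algebra_simps)
qed

text \<open>For 0 < r < sqrt R the expression equals 2 (S(x) - S(r^2)) C F(r^2). The last two
  factors do not vanish and S is strictly increasing, so sqrt x is the only zero in that
  range.\<close>

lemma smallest_pos_zero_eq:
  assumes x: "0 < x" "x < R" and C: "C \<noteq> 0" and k: "2 * eval_fps S x = k * (1 - \<alpha>)"
    and lam: "lam = (\<lambda>z. C * \<Phi> (z\<^sup>2))"
  shows "smallest_pos_zero (\<lambda>r. of_real r * deriv lam (of_real r) - of_real (k * (\<alpha> - 1)) * lam (of_real r)) (sqrt x)"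
proof -
  have val: "of_real r * deriv lam (of_real r) - of_real (k * (\<alpha> - 1)) * lam (of_real r)
      = 2 * of_real (eval_fps S x - eval_fps S (r\<^sup>2)) * (C * \<Phi> (of_real (r\<^sup>2)))"
    if "0 < r" "r < sqrt R" for r
  proof -
    have "r\<^sup>2 < R" using that R_pos by (metis real_less_rsqrt real_sqrt_less_iff real_sqrt_unique less_imp_le)
    then have \<Psi>: "\<Psi> ((of_real r)\<^sup>2) = of_real (eval_fps S (r\<^sup>2))"
      using \<Psi>_of_real[of "r\<^sup>2"] by simp
    have "k * (\<alpha> - 1) = - (2 * eval_fps S x)" using k by (simp add: algebra_simps)
    then have e1: "complex_of_real (k * (\<alpha> - 1)) = - (2 * of_real (eval_fps S x))" by (simp only:) simp
    have e2: "of_real r * deriv lam (of_real r) = - 2 * \<Psi> ((of_real r)\<^sup>2) * (C * \<Phi> ((of_real r)\<^sup>2))"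
      unfolding lam using that by (intro z_deriv_\<Phi>_square) simp
    show ?thesis unfolding e1 e2 \<Psi> by (simp add: lam algebra_simps)
  qed
  show ?thesis
    unfolding smallest_pos_zero_def
  proof (intro conjI allI impI)
    show "of_real (sqrt x) * deriv lam (of_real (sqrt x))
        - of_real (k * (\<alpha> - 1)) * lam (of_real (sqrt x)) = 0"
      using x by (subst val) auto
  next
    fix y assume y: "0 < y \<and> of_real y * deriv lam (of_real y) - of_real (k * (\<alpha> - 1)) * lam (of_real y) = 0"
    show "sqrt x \<le> y"
    proof (rule ccontr)
      assume "\<not> sqrt x \<le> y"
      then have "y\<^sup>2 < (sqrt x)\<^sup>2" using y by (intro power_strict_mono) auto
      moreover have "y < sqrt R"
        using \<open>\<not> sqrt x \<le> y\<close> real_sqrt_less_mono[OF x(2)] by linarith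
      ultimately have less: "y\<^sup>2 < x" "y < sqrt R" using x by auto
      have "eval_fps S (y\<^sup>2) < eval_fps S x"
        using less x by (intro eval_S_strict_mono) auto
      moreover have "\<Phi> (of_real (y\<^sup>2)) \<noteq> 0"
        using less x by (intro \<Phi>_nonzero) (simp add: norm_power)
      ultimately show False using val[of y] y less C by auto
    qed
  qed (use x in auto)
qed

end

lemma smallest_pos_zero_sqrt:
  assumes "smallest_pos_zero G (sqrt x)" "0 < x"
  shows "smallest_pos_zero (\<lambda>r. G (sqrt r)) x"
  unfolding smallest_pos_zero_def
proof (intro conjI allI impI)
  fix y assume y: "0 < y \<and> G (sqrt y) = 0"
  then have "0 < sqrt y \<and> G (sqrt y) = 0" by simp
  then have "sqrt x \<le> sqrt y" using assms unfolding smallest_pos_zero_def by blast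
  then show "x \<le> y" by simp
qed (use assms in \<open>auto simp: smallest_pos_zero_def\<close>)

text \<open>The branch is exp(s L) for a holomorphic L with exp(L) = F; differentiating the latter
  relation gives L' = F'/F.\<close>

lemma power_branch_has_field_derivative:
  assumes D: "open D" "convex D" "0 \<in> D" and F: "F holomorphic_on D" "\<And>z. z \<in> D \<Longrightarrow> F z \<noteq> 0" "F 0 = 1"
    and z: "z \<in> D"
  shows "power_branch D F s z \<noteq> 0"
    and "(power_branch D F s has_field_derivative of_real s * (deriv F z / F z) * power_branch D F s z) (at z)"
proof -
  have "is_power_branch D F s (power_branch D F s)"
    unfolding power_branch_def using is_power_branch_exists[OF D F] by (rule someI_ex)
  then obtain L where L: "L holomorphic_on D" "\<And>z. z \<in> D \<Longrightarrow> exp (L z) = F z"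
      "\<And>z. z \<in> D \<Longrightarrow> power_branch D F s z = exp (of_real s * L z)"
    unfolding is_power_branch_def by blast
  show "power_branch D F s z \<noteq> 0" by (simp add: L(3) z)
  have dL: "(L has_field_derivative deriv L z) (at z)"
    using L(1) D(1) z by (rule holomorphic_derivI)
  have "(F has_field_derivative exp (L z) * deriv L z) (at z)"
    by (rule has_field_derivative_transform_within_open[OF DERIV_fun_exp[OF dL] D(1) z]) (simp add: L(2))
  then have "deriv F z = F z * deriv L z"
    using DERIV_imp_deriv L(2)[OF z] by metis
  then have "deriv L z = deriv F z / F z" using F(2)[OF z] by simp
  moreover have "(power_branch D F s has_field_derivative exp (of_real s * L z) * (of_real s * deriv L z)) (at z)"
    by (rule has_field_derivative_transform_within_open[OF DERIV_fun_exp[OF DERIV_cmult[OF dL]] D(1) z])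
      (simp add: L(3))
  ultimately show "(power_branch D F s has_field_derivative of_real s * (deriv F z / F z) * power_branch D F s z) (at z)"
    using L(3)[OF z] by (simp add: mult_ac)
qed

section \<open>The coefficients of the series\<close>

lemma convergent_prod_qpoch_inf:
  assumes "0 < q" "q < 1"
  shows "convergent_prod (\<lambda>k. 1 - a * q ^ k :: real)"
proof -
  have "summable (\<lambda>k. \<bar>a\<bar> * q ^ k)"
    using assms by (intro summable_mult summable_geometric) auto
  then have "summable (\<lambda>k. norm (1 - a * q ^ k - 1))"
    using assms by (simp add: abs_mult)
  then show ?thesis
    by (intro abs_convergent_prod_imp_convergent_prod summable_imp_abs_convergent_prod)
qed

lemma qpoch_inf_nonzero:
  assumes "0 < q" "q < 1" "0 \<le> a" "a < 1"
  shows "qpoch_inf a q \<noteq> 0"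
proof -
  have "a * q ^ k \<noteq> 1" for k
    using mult_power_less_one[of a q k] assms by simp
  then show ?thesis
    unfolding qpoch_inf_def using convergent_prod_qpoch_inf[OF assms(1,2)]
    by (intro prodinf_nonzero) auto
qed

lemma qpoch_inf_split:
  assumes "0 < q" "q < 1" "a \<noteq> 1"
  shows "qpoch_inf a q = (1 - a) * qpoch_inf (a * q) q"
  using prodinf_split_head[OF convergent_prod_qpoch_inf[OF assms(1,2), of a]] assms
  by (simp add: qpoch_inf_def mult.assoc)

lemma powr_less_one_of_base:
  assumes "0 < q" "q < 1" "0 < x"
  shows "q powr x < (1::real)"
  using assms powr_less_mono'[of q 0 x] by simp

lemma q_gamma_nonzero:
  assumes "0 < q" "q < 1" "0 < x"
  shows "q_gamma q x \<noteq> 0"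
  using assms qpoch_inf_nonzero[of q q] qpoch_inf_nonzero[of q "q powr x"] powr_less_one_of_base[of q x]
  by (simp add: q_gamma_def)

text \<open>Raising x by 1 removes the first factor of the infinite product in the denominator and
  one power of 1 - q.\<close>

lemma q_gamma_plus1:
  assumes "0 < q" "q < 1" "0 < x"
  shows "q_gamma q (x + 1) = (1 - q powr x) / (1 - q) * q_gamma q x"
proof -
  have less: "q powr x < 1" using assms powr_less_one_of_base by simp
  have split: "qpoch_inf (q powr x) q = (1 - q powr x) * qpoch_inf (q powr (x + 1)) q"
    using assms less qpoch_inf_split[of q "q powr x"] by (simp add: powr_add)
  have pw: "(1 - q) powr (1 - x) = (1 - q) powr (1 - (x + 1)) * (1 - q)"
    using assms powr_add[of "1 - q" "- x" 1] by (simp add: add.commute)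
  have "qpoch_inf (q powr (x + 1)) q \<noteq> 0"
    using assms powr_less_one_of_base[of q "x + 1"] by (intro qpoch_inf_nonzero) auto
  then show ?thesis
    unfolding q_gamma_def split pw using assms less by simp
qed

section \<open>The series normalised to constant term 1, and its coefficient recurrence\<close>

definition E_fps :: "real \<Rightarrow> real \<Rightarrow> real \<Rightarrow> real fps" where
  "E_fps \<gamma> \<sigma> q = Abs_fps (\<lambda>n. q_gamma q (\<gamma> + 1) *
     ((-1) ^ n * \<sigma> ^ (2 * n) * q ^ (n * (n - 1)) / q_gamma q (2 * real n + \<gamma> + 1)))"

text \<open>The quotient of consecutive coefficients up to sign. It is arranged in powers of q^2 to
  match the q-Bessel recurrence with p = q^2.\<close>

definition E_ratio :: "real \<Rightarrow> real \<Rightarrow> real \<Rightarrow> nat \<Rightarrow> real" where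
  "E_ratio \<gamma> \<sigma> q n = \<sigma>\<^sup>2 * (1 - q)\<^sup>2 * (q\<^sup>2) ^ n /
     ((1 - q powr (\<gamma> + 1) * (q\<^sup>2) ^ n) * (1 - q powr (\<gamma> + 2) * (q\<^sup>2) ^ n))"

lemma E_fps_0:
  assumes "0 < q" "q < 1" "0 \<le> \<gamma>"
  shows "fps_nth (E_fps \<gamma> \<sigma> q) 0 = 1"
  using assms q_gamma_nonzero[of q "\<gamma> + 1"] by (simp add: E_fps_def)

text \<open>The argument of the q-gamma function grows by 2, so its functional equation is applied
  twice; the powers of q combine by (n+1) n = 2 n + n (n-1).\<close>

lemma E_fps_Suc:
  assumes q: "0 < q" "q < 1" and "0 \<le> \<gamma>"
  shows "fps_nth (E_fps \<gamma> \<sigma> q) (Suc n) = - E_ratio \<gamma> \<sigma> q n * fps_nth (E_fps \<gamma> \<sigma> q) n"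
proof -
  define x where "x = 2 * real n + \<gamma> + 1"
  have x: "0 < x" using assms by (simp add: x_def)
  have nz: "q_gamma q x \<noteq> 0" "q powr x < 1" "q powr (x + 1) < 1"
    using q x q_gamma_nonzero powr_less_one_of_base by auto
  have "q_gamma q (x + 1 + 1) = (1 - q powr (x + 1)) / (1 - q) * ((1 - q powr x) / (1 - q) * q_gamma q x)"
    using q x by (subst q_gamma_plus1) (auto simp: q_gamma_plus1)
  then have g: "q_gamma q (2 * real (Suc n) + \<gamma> + 1) =
      (1 - q powr x) * (1 - q powr (x + 1)) / (1 - q)\<^sup>2 * q_gamma q x"
    by (simp add: x_def power2_eq_square add_ac)
  have pn: "(q\<^sup>2) ^ n = q powr (2 * real n)"
    using q powr_realpow[of q "2 * n"] by (simp add: power_mult)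
  then have pw: "q powr (\<gamma> + 1) * (q\<^sup>2) ^ n = q powr x" "q powr (\<gamma> + 2) * (q\<^sup>2) ^ n = q powr (x + 1)"
    unfolding pn powr_add[symmetric] x_def by (simp_all add: add_ac)
  have qn: "q ^ (Suc n * (Suc n - 1)) = (q\<^sup>2) ^ n * q ^ (n * (n - 1))"
  proof -
    have "Suc n * (Suc n - 1) = 2 * n + n * (n - 1)" by (cases n) simp_all
    then show ?thesis by (simp only: power_add power_mult)
  qed
  show ?thesis
    using q nz unfolding E_fps_def E_ratio_def pw fps_nth_Abs_fps g x_def[symmetric] qn
    by (simp add: power2_eq_square mult_ac)
qed

lemma E_ratio_pos:
  assumes "0 < q" "q < 1" "0 \<le> \<gamma>" "0 < \<sigma>"
  shows "0 < E_ratio \<gamma> \<sigma> q n"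
proof -
  have "q powr x * (q\<^sup>2) ^ n < 1" if "0 < x" for x
    using assms that powr_less_one_of_base[of q x] by (intro mult_power_less_one) (auto simp: power_le_one)
  then show ?thesis using assms by (simp add: E_ratio_def)
qed

text \<open>The numerator gains exactly the factor q^2, while both factors of the denominator
  increase.\<close>

lemma E_ratio_Suc_le:
  assumes q: "0 < q" "q < 1" and "0 \<le> \<gamma>" "0 < \<sigma>"
  shows "E_ratio \<gamma> \<sigma> q (Suc n) \<le> q\<^sup>2 * E_ratio \<gamma> \<sigma> q n"
proof -
  have less: "q powr x * (q\<^sup>2) ^ n < 1" if "0 < x" for x n
    using that assms powr_less_one_of_base[of q x] by (intro mult_power_less_one) (auto simp: power_le_one)
  have mono: "1 - q powr x * (q\<^sup>2) ^ n \<le> 1 - q powr x * (q\<^sup>2) ^ Suc n" for x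
  proof -
    have "(q\<^sup>2) ^ Suc n \<le> (q\<^sup>2) ^ n" using q by (intro power_decreasing) (auto simp: power_le_one)
    then show ?thesis by (simp add: mult_left_mono)
  qed
  have "E_ratio \<gamma> \<sigma> q (Suc n) \<le> \<sigma>\<^sup>2 * (1 - q)\<^sup>2 * (q\<^sup>2) ^ Suc n /
     ((1 - q powr (\<gamma> + 1) * (q\<^sup>2) ^ n) * (1 - q powr (\<gamma> + 2) * (q\<^sup>2) ^ n))"
    unfolding E_ratio_def using assms less[of "\<gamma> + 1" "Suc n"] less[of "\<gamma> + 1" n] less[of "\<gamma> + 2" n] less[of "\<gamma> + 2" "Suc n"]
    by (intro divide_left_mono mult_mono mono mult_pos_pos) (auto simp: less_imp_le)
  then show ?thesis by (simp add: E_ratio_def mult_ac)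
qed

lemma fps_conv_radius_E_fps:
  assumes q: "0 < q" "q < 1" and "0 \<le> \<gamma>" "0 < \<sigma>"
  shows "fps_conv_radius (E_fps \<gamma> \<sigma> q) = \<infinity>"
  unfolding fps_conv_radius_def
proof (rule conv_radius_inftyI'')
  fix z :: real
  let ?d = "E_ratio \<gamma> \<sigma> q"
  have d_pos: "0 < ?d n" for n using assms by (rule E_ratio_pos)
  have d_le: "?d n \<le> ?d 0 * (q\<^sup>2) ^ n" for n
  proof (induction n)
    case (Suc n)
    have "q\<^sup>2 * ?d n \<le> q\<^sup>2 * (?d 0 * (q\<^sup>2) ^ n)" using Suc by (intro mult_left_mono) auto
    then show ?case using E_ratio_Suc_le[OF assms, of n] by (simp add: mult_ac)
  qed simp
  have "\<bar>q\<^sup>2\<bar> < 1" using q by (simp add: power_less_one_iff)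
  then have "(\<lambda>n. ?d 0 * (q\<^sup>2) ^ n * \<bar>z\<bar>) \<longlonglongrightarrow> ?d 0 * 0 * \<bar>z\<bar>"
    by (intro tendsto_intros LIMSEQ_power_zero) simp
  then have "\<forall>\<^sub>F n in sequentially. ?d 0 * (q\<^sup>2) ^ n * \<bar>z\<bar> < 1 / 2"
    by (intro order_tendstoD) auto
  then obtain N where N: "\<And>n. N \<le> n \<Longrightarrow> ?d 0 * (q\<^sup>2) ^ n * \<bar>z\<bar> < 1 / 2"
    unfolding eventually_sequentially by auto
  show "summable (\<lambda>n. fps_nth (E_fps \<gamma> \<sigma> q) n * z ^ n)"
  proof (rule summable_ratio_test[of "1 / 2" N])
    fix n assume "N \<le> n"
    then have "?d n * \<bar>z\<bar> \<le> 1 / 2"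
      using N[of n] mult_right_mono[OF d_le[of n], of "\<bar>z\<bar>"] by simp
    then have "?d n * \<bar>z\<bar> * norm (fps_nth (E_fps \<gamma> \<sigma> q) n * z ^ n)
        \<le> 1 / 2 * norm (fps_nth (E_fps \<gamma> \<sigma> q) n * z ^ n)"
      by (intro mult_right_mono) auto
    then show "norm (fps_nth (E_fps \<gamma> \<sigma> q) (Suc n) * z ^ Suc n)
        \<le> 1 / 2 * norm (fps_nth (E_fps \<gamma> \<sigma> q) n * z ^ n)"
      using d_pos[of n] q \<open>0 \<le> \<gamma>\<close> by (simp add: E_fps_Suc abs_mult mult_ac)
  qed simp
qed

lemma E_fun_eq:
  assumes "0 < q" "q < 1" "0 \<le> \<gamma>" "0 < \<sigma>"
  shows "of_real (q_gamma q (\<gamma> + 1)) * E_fun \<gamma> \<sigma> q z = eval_fps (complex_fps (E_fps \<gamma> \<sigma> q)) z"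
proof -
  let ?g = "q_gamma q (\<gamma> + 1)"
  let ?t = "\<lambda>n. complex_of_real ((-1) ^ n * \<sigma> ^ (2 * n) * q ^ (n * (n - 1))
             / q_gamma q (2 * real n + \<gamma> + 1)) * z ^ n"
  have g: "?g \<noteq> 0" using assms by (intro q_gamma_nonzero) auto
  have eq: "fps_nth (complex_fps (E_fps \<gamma> \<sigma> q)) n * z ^ n = of_real ?g * ?t n" for n
    by (simp add: E_fps_def)
  have "summable (\<lambda>n. fps_nth (complex_fps (E_fps \<gamma> \<sigma> q)) n * z ^ n)"
    using assms by (intro summable_fps) (simp add: fps_conv_radius_E_fps)
  then have "summable (\<lambda>n. of_real ?g * ?t n)" unfolding eq .
  then have "summable ?t" using g summable_cmult_iff[of "of_real ?g" ?t] by simp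
  then show ?thesis
    unfolding E_fun_def eval_fps_def eq by (rule suminf_mult[symmetric])
qed

lemma E_fps_positive_log_deriv:
  assumes q: "0 < q" "q < 1" and \<gamma>: "0 \<le> \<gamma>" and \<sigma>: "0 < \<sigma>"
    and cond: "\<gamma> \<in> {0, 1} \<or> inverse q * (1 - q) * (1 - q powr (\<gamma> + 1)) * (1 - q powr (\<gamma> + 2)) > 1"
  shows "\<exists>\<beta>. positive_log_deriv (E_fps \<gamma> \<sigma> q) \<beta>"
proof -
  let ?F = "E_fps \<gamma> \<sigma> q"
  let ?d = "E_ratio \<gamma> \<sigma> q"
  note basic = E_fps_0[OF q \<gamma>, of \<sigma>] fps_conv_radius_E_fps[OF q \<gamma> \<sigma>]
  \<comment> \<open>Applies as soon as one of the two denominator factors of \<open>E_ratio\<close>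
    is 1 - (q^2)^(n+1); the other one supplies c. This gives c = q for \<gamma> = 0 and c = q^3 for
    \<gamma> = 1.\<close>
  have bessel: ?thesis
    if c: "0 < c" "c < 1" and d: "\<And>n. (1 - (q\<^sup>2) ^ Suc n) * (1 - c * (q\<^sup>2) ^ n) * ?d n = \<sigma>\<^sup>2 * (1 - q)\<^sup>2 * (q\<^sup>2) ^ n" for c
  proof -
    have "(\<sigma>\<^sup>2 * (1 - q)\<^sup>2 / (1 - c)) ^ Suc n \<le> fps_nth (neg_log_deriv ?F) (Suc n)" for n
    proof (rule neg_log_deriv_ge_of_q_bessel)
      show "0 < q\<^sup>2" "q\<^sup>2 < 1" "0 < c" "c < 1" "0 < \<sigma>\<^sup>2 * (1 - q)\<^sup>2" "fps_nth ?F 0 = 1"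
        using q c \<sigma> basic by (auto simp: power_less_one_iff)
      fix n
      show "(1 - (q\<^sup>2) ^ Suc n) * (1 - c * (q\<^sup>2) ^ n) * fps_nth ?F (Suc n)
          = - (\<sigma>\<^sup>2 * (1 - q)\<^sup>2 * (q\<^sup>2) ^ n * fps_nth ?F n)"
        unfolding E_fps_Suc[OF q \<gamma>] d[of n, symmetric] by simp
    qed
    then have "positive_log_deriv ?F (\<sigma>\<^sup>2 * (1 - q)\<^sup>2 / (1 - c))"
      using basic q c \<sigma> by unfold_locales auto
    then show ?thesis ..
  qed
  have q2: "(q\<^sup>2) ^ Suc n < 1" for n
    using q power_less_one_iff[of "q\<^sup>2" "Suc n"] power_less_one_iff[of q 2] by auto
  have cq: "c * (q\<^sup>2) ^ n < 1" if "0 < c" "c < 1" for c n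
    using that q by (intro mult_power_less_one) (auto simp: power_le_one)
  consider "\<gamma> = 0" | "\<gamma> = 1" | "inverse q * (1 - q) * (1 - q powr (\<gamma> + 1)) * (1 - q powr (\<gamma> + 2)) > 1"
    using cond by auto
  then show ?thesis
  proof cases
    case 1
    show ?thesis
    proof (rule bessel)
      fix n
      have "q powr (\<gamma> + 1) = q" "q powr (\<gamma> + 2) * (q\<^sup>2) ^ n = (q\<^sup>2) ^ Suc n"
        using 1 q by simp_all
      then show "(1 - (q\<^sup>2) ^ Suc n) * (1 - q * (q\<^sup>2) ^ n) * ?d n = \<sigma>\<^sup>2 * (1 - q)\<^sup>2 * (q\<^sup>2) ^ n"
        using q2[of n] cq[of q n] q unfolding E_ratio_def by simp
    qed (use q in auto)
  next
    case 2
    show ?thesis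
    proof (rule bessel)
      show "0 < q ^ 3" "q ^ 3 < 1" using q by (auto simp: power_less_one_iff)
      fix n
      have "q powr (\<gamma> + 1) * (q\<^sup>2) ^ n = (q\<^sup>2) ^ Suc n" "q powr (\<gamma> + 2) = q ^ 3"
        using 2 q by simp_all
      then show "(1 - (q\<^sup>2) ^ Suc n) * (1 - q ^ 3 * (q\<^sup>2) ^ n) * ?d n = \<sigma>\<^sup>2 * (1 - q)\<^sup>2 * (q\<^sup>2) ^ n"
        using q2[of n] cq[of "q ^ 3" n] q unfolding E_ratio_def by (simp add: power_less_one_iff)
    qed
  next
    case 3
    have ab: "0 < 1 - q powr (\<gamma> + 1)" "1 - q powr (\<gamma> + 1) \<le> 1" "0 < 1 - q powr (\<gamma> + 2)" "1 - q powr (\<gamma> + 2) \<le> 1"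
      using q \<gamma> powr_less_one_of_base[of q "\<gamma> + 1"] powr_less_one_of_base[of q "\<gamma> + 2"] by auto
    \<comment> \<open>Both factors are at most 1, so the hypothesis leaves (1 - q)/q > 1, that is, q
      < 1/2. Then q^2 is at most 1/4, as the quarter-ratio criterion requires.\<close>
    have "(1 - q powr (\<gamma> + 1)) * (1 - q powr (\<gamma> + 2)) \<le> 1"
      using ab by (intro mult_le_one) auto
    then have "inverse q * (1 - q) * ((1 - q powr (\<gamma> + 1)) * (1 - q powr (\<gamma> + 2))) \<le> inverse q * (1 - q) * 1"
      using q by (intro mult_left_mono) auto
    then have "1 < inverse q * (1 - q)" using 3 by (simp only: mult_ac)
    then have "q < 1 / 2" using q by (simp add: field_simps)
    then have "q\<^sup>2 \<le> (1 / 2)\<^sup>2" using q by (intro power_mono) auto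
    then have q4: "q\<^sup>2 \<le> 1 / 4" by (simp add: power2_eq_square)
    then have "?d (Suc n) \<le> ?d n / 4" for n
      using E_ratio_Suc_le[OF q \<gamma> \<sigma>, of n] mult_right_mono[OF q4, of "?d n"] E_ratio_pos[OF q \<gamma> \<sigma>, of n]
      by linarith
    then have "(?d 0 / 2) ^ Suc n \<le> fps_nth (neg_log_deriv ?F) (Suc n)" for n
      using E_fps_0[OF q \<gamma>] E_fps_Suc[OF q \<gamma>] E_ratio_pos[OF q \<gamma> \<sigma>]
      by (intro neg_log_deriv_ge_of_quarter_ratio) auto
    then have "positive_log_deriv ?F (?d 0 / 2)"
      using basic E_ratio_pos[OF q \<gamma> \<sigma>, of 0] by unfold_locales auto
    then show ?thesis ..
  qed
qed

section \<open>The three radii of starlikeness\<close>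

theorem theorem1p1:
  fixes q \<sigma> \<gamma> \<alpha> :: real
  assumes "0 < q" "q < 1" "\<sigma> > 0" "0 \<le> \<gamma>" "\<gamma> < 2"
    and "\<gamma> \<in> {0, 1} \<or>
         (\<gamma> \<in> {0<..<2} - {1} \<and>
          inverse q * (1 - q) * (1 - q powr (\<gamma> + 1)) * (1 - q powr (\<gamma> + 2)) > 1)"
    and "0 \<le> \<alpha>" "\<alpha> < 1"
  shows "(\<exists>x. smallest_pos_zero
            (\<lambda>r. of_real r * deriv (lambda_fun \<gamma> \<sigma> q) (of_real r)
                 - of_real ((\<gamma> + 1) * (\<alpha> - 1)) * lambda_fun \<gamma> \<sigma> q (of_real r)) x \<and>
          starlike_radius (f_domain \<gamma> \<sigma> q) (f_fun \<gamma> \<sigma> q) \<alpha> = ereal x) \<and>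
         (\<exists>y. smallest_pos_zero
            (\<lambda>r. of_real r * deriv (lambda_fun \<gamma> \<sigma> q) (of_real r)
                 - of_real (\<alpha> - 1) * lambda_fun \<gamma> \<sigma> q (of_real r)) y \<and>
          starlike_radius UNIV (g_fun \<gamma> \<sigma> q) \<alpha> = ereal y) \<and>
         (\<exists>z. smallest_pos_zero
            (\<lambda>r. of_real (sqrt r) * deriv (lambda_fun \<gamma> \<sigma> q) (of_real (sqrt r))
                 - of_real (2 * (\<alpha> - 1)) * lambda_fun \<gamma> \<sigma> q (of_real (sqrt r))) z \<and>
          starlike_radius UNIV (h_fun \<gamma> \<sigma> q) \<alpha> = ereal z)"
proof -
  note q = assms(1,2) and \<sigma> = assms(3) and \<gamma> = assms(4) and \<alpha> = assms(8)
  obtain \<beta> where "positive_log_deriv (E_fps \<gamma> \<sigma> q) \<beta>"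
    using E_fps_positive_log_deriv[OF q \<gamma> \<sigma>] assms(6) by blast
  then interpret positive_log_deriv "E_fps \<gamma> \<sigma> q" \<beta> .
  define G where "G = complex_of_real (q_gamma q (\<gamma> + 1))"
  have G: "G \<noteq> 0" using q_gamma_nonzero[OF q, of "\<gamma> + 1"] \<gamma> by (simp add: G_def)
  have GE: "G * E_fun \<gamma> \<sigma> q z = \<Phi> z" for z
    unfolding G_def by (rule E_fun_eq[OF q \<gamma> \<sigma>])
  have E: "E_fun \<gamma> \<sigma> q = (\<lambda>z. inverse G * \<Phi> z)"
    using G by (auto simp flip: GE)
  have lam: "lambda_fun \<gamma> \<sigma> q = (\<lambda>z. inverse G * \<Phi> (z\<^sup>2))"
    by (auto simp: lambda_fun_def E)
  have sqrtR: "(sqrt R)\<^sup>2 = R" "0 < sqrt R" using R_pos by auto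
  \<comment> \<open>The three equations are the cases k = \<gamma> + 1, k = 1 and k = 2, the last
    one after substituting sqrt r for r.\<close>
  have zero: "smallest_pos_zero (\<lambda>r. of_real r * deriv (lambda_fun \<gamma> \<sigma> q) (of_real r)
      - of_real (k * (\<alpha> - 1)) * lambda_fun \<gamma> \<sigma> q (of_real r)) (sqrt x)"
    if "0 < x" "x < R" "2 * eval_fps S x = k * (1 - \<alpha>)" for x k
    using smallest_pos_zero_eq[OF that(1,2) _ that(3) lam] G by simp
  have norm_sq: "norm (z\<^sup>2) < R" if "norm z < sqrt R" for z :: complex
    using power_strict_mono[OF that, of 2] sqrtR by (simp add: norm_power)
  have a: "\<exists>x. smallest_pos_zero
            (\<lambda>r. of_real r * deriv (lambda_fun \<gamma> \<sigma> q) (of_real r)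
                 - of_real ((\<gamma> + 1) * (\<alpha> - 1)) * lambda_fun \<gamma> \<sigma> q (of_real r)) x \<and>
          starlike_radius (f_domain \<gamma> \<sigma> q) (f_fun \<gamma> \<sigma> q) \<alpha> = ereal x"
  proof -
    define D where "D = f_domain \<gamma> \<sigma> q"
    have lam_R: "lambda_fun \<gamma> \<sigma> q (of_real (sqrt R)) = 0"
      using \<Phi>_R R_pos by (simp add: lam flip: of_real_power)
    \<comment> \<open>The first zero of F on the positive axis is R, so sqrt R is a zero of
      \<open>lambda_fun\<close> that lies in every larger disk.\<close>
    have D_eq: "D = ball 0 (sqrt R)"
    proof
      show "ball 0 (sqrt R) \<subseteq> D"
      proof -
        have "\<forall>z\<in>ball 0 (sqrt R). lambda_fun \<gamma> \<sigma> q z \<noteq> 0"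
          using norm_sq \<Phi>_nonzero G by (auto simp: lam)
        then show ?thesis unfolding D_def f_domain_def by blast
      qed
      have "r \<le> sqrt R" if "\<forall>z\<in>ball 0 r. lambda_fun \<gamma> \<sigma> q z \<noteq> 0" for r
        using lam_R sqrtR(2) that by (force simp: not_less[symmetric])
      then show "D \<subseteq> ball 0 (sqrt R)"
        unfolding D_def f_domain_def by force
    qed
    define p where "p = power_branch D (\<lambda>w. \<Phi> (w\<^sup>2)) (1 / (\<gamma> + 1))"
    have f_eq: "f_fun \<gamma> \<sigma> q = (\<lambda>z. z * p z)"
      unfolding f_fun_def p_def D_def using G
      by (simp add: lam G_def[symmetric] flip: mult.assoc)
    have sq_deriv: "((\<lambda>z. \<Phi> (z\<^sup>2)) has_field_derivative (2 * z * deriv \<Phi> (z\<^sup>2))) (at z)" for z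
      using \<Phi>_square_deriv[of 1 z] by simp
    have p: "p z \<noteq> 0"
      "(p has_field_derivative of_real (1 / (\<gamma> + 1)) * (deriv (\<lambda>z. \<Phi> (z\<^sup>2)) z / \<Phi> (z\<^sup>2)) * p z) (at z)"
      if "norm z < sqrt R" for z
    proof -
      have prem: "open D" "convex D" "0 \<in> D" "z \<in> D" "\<Phi> (0\<^sup>2) = 1" "\<And>w. w \<in> D \<Longrightarrow> \<Phi> (w\<^sup>2) \<noteq> 0"
        using that R_pos norm_sq \<Phi>_nonzero by (auto simp: D_eq)
      have holo: "(\<lambda>w. \<Phi> (w\<^sup>2)) holomorphic_on D"
        using sq_deriv prem(1) by (auto simp: holomorphic_on_open)
      show "p z \<noteq> 0"
        unfolding p_def by (rule power_branch_has_field_derivative(1)[OF prem(1-3) holo prem(6,5,4)])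
      show "(p has_field_derivative of_real (1 / (\<gamma> + 1)) * (deriv (\<lambda>z. \<Phi> (z\<^sup>2)) z / \<Phi> (z\<^sup>2)) * p z) (at z)"
        unfolding p_def by (rule power_branch_has_field_derivative(2)[OF prem(1-3) holo prem(6,5,4)])
    qed
    \<comment> \<open>The value solves (2/(\<gamma> + 1)) S(x) = 1 - \<alpha>. Since x stands for
      the square of the modulus, the radius is sqrt x.\<close>
    obtain x where x: "0 < x" "x < R" "eval_fps S x = (\<gamma> + 1) * (1 - \<alpha>) / 2"
      using eval_S_surj[of "(\<gamma> + 1) * (1 - \<alpha>) / 2"] \<gamma> \<alpha> by auto
    have "starlike_radius D (f_fun \<gamma> \<sigma> q) \<alpha> = ereal (sqrt x)"
    proof (rule starlike_radius_eq[where \<rho> = "sqrt R" and m = 2 and k = "2 / (\<gamma> + 1)"])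
      fix z :: complex assume z: "z \<noteq> 0" "norm z < sqrt R"
      show "f_fun \<gamma> \<sigma> q z \<noteq> 0" using p(1) z by (simp add: f_eq)
      have "deriv (f_fun \<gamma> \<sigma> q) z = p z + z * (of_real (1 / (\<gamma> + 1)) * (deriv (\<lambda>z. \<Phi> (z\<^sup>2)) z / \<Phi> (z\<^sup>2)) * p z)"
        unfolding f_eq using DERIV_mult[OF DERIV_ident p(2)[OF z(2)]]
        by (intro DERIV_imp_deriv) (simp add: mult_ac)
      then have "z * deriv (f_fun \<gamma> \<sigma> q) z / f_fun \<gamma> \<sigma> q z
          = 1 + of_real (1 / (\<gamma> + 1)) * (z * deriv (\<lambda>z. \<Phi> (z\<^sup>2)) z / \<Phi> (z\<^sup>2))"
        using z p(1)[OF z(2)] by (simp add: f_eq field_simps)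
      also have "z * deriv (\<lambda>z. \<Phi> (z\<^sup>2)) z / \<Phi> (z\<^sup>2) = - 2 * \<Psi> (z\<^sup>2)"
        using z_deriv_\<Phi>_square[OF z(2), of 1] \<Phi>_nonzero[OF norm_sq[OF z(2)]] by simp
      finally show "z * deriv (f_fun \<gamma> \<sigma> q) z / f_fun \<gamma> \<sigma> q z = 1 - of_real (2 / (\<gamma> + 1)) * \<Psi> (z\<^sup>2)"
        by simp
    qed (use x \<gamma> \<alpha> sqrtR in \<open>auto simp: D_eq field_simps\<close>)
    moreover have "2 * eval_fps S x = (\<gamma> + 1) * (1 - \<alpha>)" using x by simp
    ultimately show ?thesis using zero[OF x(1,2)] unfolding D_def by blast
  qed
  have b: "\<exists>y. smallest_pos_zero
            (\<lambda>r. of_real r * deriv (lambda_fun \<gamma> \<sigma> q) (of_real r)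
                 - of_real (\<alpha> - 1) * lambda_fun \<gamma> \<sigma> q (of_real r)) y \<and>
          starlike_radius UNIV (g_fun \<gamma> \<sigma> q) \<alpha> = ereal y"
  proof -
    obtain x where x: "0 < x" "x < R" "eval_fps S x = (1 - \<alpha>) / 2"
      using eval_S_surj[of "(1 - \<alpha>) / 2"] \<alpha> by auto
    have g_eq: "g_fun \<gamma> \<sigma> q = (\<lambda>z. z * \<Phi> (z\<^sup>2))"
      unfolding g_fun_def G_def[symmetric] mult.assoc GE ..
    have "starlike_radius UNIV (g_fun \<gamma> \<sigma> q) \<alpha> = ereal (sqrt x)"
    proof (rule starlike_radius_eq[where \<rho> = "sqrt R" and m = 2 and k = 2])
      fix z :: complex assume z: "z \<noteq> 0" "norm z < sqrt R"
      note nz = \<Phi>_nonzero[OF norm_sq[OF z(2)]]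
      show "g_fun \<gamma> \<sigma> q z \<noteq> 0" using nz z by (simp add: g_eq)
      have d: "((\<lambda>z. \<Phi> (z\<^sup>2)) has_field_derivative deriv (\<lambda>z. \<Phi> (z\<^sup>2)) z) (at z)"
        using \<Phi>_square_deriv[of 1 z] DERIV_imp_deriv by fastforce
      have "deriv (g_fun \<gamma> \<sigma> q) z = \<Phi> (z\<^sup>2) + z * deriv (\<lambda>z. \<Phi> (z\<^sup>2)) z"
        unfolding g_eq using DERIV_mult[OF DERIV_ident d]
        by (intro DERIV_imp_deriv) (simp add: mult_ac)
      also have "z * deriv (\<lambda>z. \<Phi> (z\<^sup>2)) z = - 2 * \<Psi> (z\<^sup>2) * \<Phi> (z\<^sup>2)"
        using z_deriv_\<Phi>_square[OF z(2), of 1] by simp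
      finally show "z * deriv (g_fun \<gamma> \<sigma> q) z / g_fun \<gamma> \<sigma> q z = 1 - of_real 2 * \<Psi> (z\<^sup>2)"
        using z nz by (simp add: g_eq field_simps)
    qed (use x \<alpha> sqrtR in auto)
    then show ?thesis using zero[OF x(1,2), of 1] x by auto
  qed
  have c: "\<exists>z. smallest_pos_zero
            (\<lambda>r. of_real (sqrt r) * deriv (lambda_fun \<gamma> \<sigma> q) (of_real (sqrt r))
                 - of_real (2 * (\<alpha> - 1)) * lambda_fun \<gamma> \<sigma> q (of_real (sqrt r))) z \<and>
          starlike_radius UNIV (h_fun \<gamma> \<sigma> q) \<alpha> = ereal z"
  proof -
    \<comment> \<open>Here F is evaluated at z itself, so the radius is x rather than sqrt x, in
      agreement with the sqrt r in the third equation.\<close>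
    obtain x where x: "0 < x" "x < R" "eval_fps S x = 1 - \<alpha>"
      using eval_S_surj[of "1 - \<alpha>"] \<alpha> by auto
    have h_eq: "h_fun \<gamma> \<sigma> q = (\<lambda>z. z * \<Phi> z)"
      unfolding h_fun_def G_def[symmetric] mult.assoc GE ..
    have "starlike_radius UNIV (h_fun \<gamma> \<sigma> q) \<alpha> = ereal x"
    proof (rule starlike_radius_eq[where \<rho> = R and m = 1 and k = 1])
      fix z :: complex assume z: "z \<noteq> 0" "norm z < R"
      note nz = \<Phi>_nonzero[OF z(2)]
      show "h_fun \<gamma> \<sigma> q z \<noteq> 0" using nz z by (simp add: h_eq)
      have d: "(\<Phi> has_field_derivative deriv \<Phi> z) (at z)"
        using \<Phi>_holomorphic[of UNIV] by (rule holomorphic_derivI) auto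
      have "deriv (h_fun \<gamma> \<sigma> q) z = \<Phi> z + z * deriv \<Phi> z"
        unfolding h_eq using DERIV_mult[OF DERIV_ident d]
        by (intro DERIV_imp_deriv) (simp add: mult_ac)
      then show "z * deriv (h_fun \<gamma> \<sigma> q) z / h_fun \<gamma> \<sigma> q z = 1 - of_real 1 * \<Psi> (z ^ 1)"
        using z nz z_deriv_\<Phi>[OF z(2)] by (simp add: h_eq field_simps)
    qed (use x \<alpha> in auto)
    moreover have "2 * eval_fps S x = 2 * (1 - \<alpha>)" using x by simp
    ultimately show ?thesis using smallest_pos_zero_sqrt[OF zero[OF x(1,2)] x(1)] by blast
  qed
  show ?thesis using a b c by blast
qed

end
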